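(* For each integer $N\ge 1$ let $(J_{ij})_{1\le i,j\le N}$ be i.i.d. standard Gaussian random variables, let $$H(\eta)=\frac{1}{\sqrt N}\sum_{i,j=1}^N J_{ij}\eta_i\eta_j,\qquad \eta\in\{0,1\}^N,$$ and define $m_N$ by $\min_{\eta\in\{0,1\}^N}H(\eta)=-m_N N$. Then, uniformly in $N$ (that is, for every $N\ge1$), $$E(m_N)<0.562 .$$
   Context: The sum defining $H$ runs over all ordered pairs $(i,j)\in\{1,\dots,N\}^2$, including $i=j$; the $N^2$ variables $J_{ij}$ are mutually independent Gaussians with mean $0$ and variance $1$ (no symmetry $J_{ij}=J_{ji}$ is imposed). $E$ denotes expectation with respect to the $J_{ij}$. Note that $m_N\ge 0$, since $H(0)=0$. *)

theory Defs
  imports "HOL-Probability.Probability"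
begin

definition configs :: "nat \<Rightarrow> (nat \<Rightarrow> real) set"
  where "configs N = ({1..N} \<rightarrow>\<^sub>E {0, 1})"

definition hamiltonian :: "nat \<Rightarrow> (nat \<Rightarrow> nat \<Rightarrow> real) \<Rightarrow> (nat \<Rightarrow> real) \<Rightarrow> real"
  where "hamiltonian N g \<eta> = 1 / sqrt (real N) * (\<Sum>i=1..N. \<Sum>j=1..N. g i j * \<eta> i * \<eta> j)"

text \<open>For \<open>N \<ge> 1\<close> this is the unique \<open>m\<close> with
  \<open>Min (hamiltonian N g ` configs N) = - m * N\<close>.\<close>

definition min_density :: "nat \<Rightarrow> (nat \<Rightarrow> nat \<Rightarrow> real) \<Rightarrow> real"
  where "min_density N g = - Min (hamiltonian N g ` configs N) / real N"

definition iid_std_gaussian :: "'a measure \<Rightarrow> nat \<Rightarrow> (nat \<Rightarrow> nat \<Rightarrow> 'a \<Rightarrow> real) \<Rightarrow> bool"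
  where "iid_std_gaussian M N J \<longleftrightarrow>
    prob_space.indep_vars M (\<lambda>_. borel) (\<lambda>(i, j). J i j) ({1..N} \<times> {1..N}) \<and>
    (\<forall>i\<in>{1..N}. \<forall>j\<in>{1..N}. distributed M lborel (J i j) std_normal_density)"

end

theory Submission
  imports Defs
begin

text \<open>
  The maximum of \<open>-H\<close> is compared with that of a Gaussian process linear in \<open>\<eta>\<close>. Writing \<open>|\<eta>| = k\<close>,
  \<open>|\<eta>'| = k'\<close> and \<open>r = \<eta> \<bullet> \<eta>'\<close>, the increments of \<open>-H\<close> have variance \<open>(k\<^sup>2 + k'\<^sup>2 - 2 r\<^sup>2) / N\<close>, while those of
  \<open>Y \<eta> = sqrt (2 k / N) * (g \<bullet> \<eta>)\<close>, with \<open>g\<close> a standard Gaussian vector, have variance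
  \<open>2 (k\<^sup>2 + k'\<^sup>2 - 2 sqrt (k k') r) / N\<close>. The latter exceeds the former by
  \<open>((k - k')\<^sup>2 + 2 (sqrt (k k') - r)\<^sup>2) / N\<close>, so the Sudakov-Fernique inequality (proved by interpolation
  and Gaussian integration by parts for the soft maximum) gives \<open>E max (-H) \<le> E max Y\<close>.

  With \<open>A\<close> the average of \<open>max 0 (g i + 1/3)\<close> one has pointwise
  \<open>max Y / N \<le> sqrt 2 / 3 * (A\<^sup>2 + A)\<close>. The expectation of the right-hand side decreases in \<open>N\<close> and is
  below \<open>0.554\<close> for \<open>N = 2\<close>. For \<open>N = 1\<close> the comparison is too lossy (\<open>E max Y = 1 / sqrt pi > 0.562\<close>),
  but there \<open>E (m 1) \<le> 1/2\<close> is immediate.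
\<close>

section \<open>Gaussian integration by parts\<close>

definition std_gauss :: "real measure"
  where "std_gauss = density lborel std_normal_density"

abbreviation std_gauss_PiM :: "'i set \<Rightarrow> ('i \<Rightarrow> real) measure"
  where "std_gauss_PiM I \<equiv> PiM I (\<lambda>_. std_gauss)"

lemma prob_space_std_gauss: "prob_space std_gauss"
  unfolding std_gauss_def by (rule prob_space_normal_density) simp

interpretation std_gauss: prob_space std_gauss
  by (rule prob_space_std_gauss)

interpretation gauss_prod: product_prob_space "\<lambda>_. std_gauss" I for I
  by unfold_locales

lemma sets_std_gauss [simp, measurable_cong]: "sets std_gauss = sets borel"
  by (simp add: std_gauss_def)

lemma space_std_gauss [simp]: "space std_gauss = UNIV"
  by (simp add: std_gauss_def)

lemma integral_std_gauss:
  assumes "f \<in> borel_measurable borel"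
  shows "integral\<^sup>L std_gauss f = (\<integral>x. std_normal_density x * f x \<partial>lborel)"
  using assms by (simp add: std_gauss_def integral_real_density)

lemma integrable_std_gauss_iff:
  assumes "f \<in> borel_measurable borel"
  shows "integrable std_gauss f \<longleftrightarrow> integrable lborel (\<lambda>x. std_normal_density x * f x)"
  using assms by (simp add: std_gauss_def integrable_real_density)

lemma integrable_std_gauss_power: "integrable std_gauss (\<lambda>x. x ^ k)"
  by (simp add: integrable_std_gauss_iff integrable_std_normal_moment)

lemma integrable_std_gauss_id: "integrable std_gauss (\<lambda>x. x)"
  using integrable_std_gauss_power[of 1] by simp

lemma integral_std_gauss_square: "(\<integral>x. x\<^sup>2 \<partial>std_gauss) = 1"
  using integral_std_normal_moment_even[of 1] by (simp add: integral_std_gauss)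

lemma integral_std_gauss_id: "(\<integral>x. x \<partial>std_gauss) = 0"
  using integral_std_normal_moment_odd[of 0] by (simp add: integral_std_gauss)

lemma std_normal_density_deriv:
  "(std_normal_density has_real_derivative - (x * std_normal_density x)) (at x)"
  unfolding std_normal_density_def
  by (auto intro!: derivative_eq_intros simp: field_simps)

lemma std_normal_density_at_top: "(std_normal_density \<longlongrightarrow> 0) at_top"
  and std_normal_density_at_bot: "(std_normal_density \<longlongrightarrow> 0) at_bot"
  unfolding std_normal_density_def by real_asymp+

text \<open>Stein's identity. With \<open>d\<close> the standard normal density,
  \<open>d' = - x d\<close>, so \<open>f d\<close> has derivative \<open>f' d - x f d\<close>. Its
  integral over the line vanishes because \<open>f\<close> is bounded and \<open>d\<close> tends to
  0 at both ends. Continuity of \<open>f'\<close> is what the fundamental theorem of calculus asks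
  for.\<close>

lemma std_gauss_by_parts:
  fixes f f' :: "real \<Rightarrow> real"
  assumes der: "\<And>x. (f has_real_derivative f' x) (at x)"
    and cont: "continuous_on UNIV f'"
    and bnd: "\<And>x. \<bar>f x\<bar> \<le> B" "\<And>x. \<bar>f' x\<bar> \<le> B'"
  shows "(\<integral>x. x * f x \<partial>std_gauss) = (\<integral>x. f' x \<partial>std_gauss)"
proof -
  let ?d = "std_normal_density"
  have contf: "continuous_on UNIV f"
    using der by (meson DERIV_isCont continuous_at_imp_continuous_on)
  have [measurable]: "f \<in> borel_measurable borel" "f' \<in> borel_measurable borel"
    using cont contf by (auto intro: borel_measurable_continuous_onI)
  have i1: "integrable std_gauss f'"
    by (rule std_gauss.integrable_const_bound[where B = B']) (auto simp: bnd)
  have i2: "integrable std_gauss (\<lambda>x. x * f x)"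
    by (rule Bochner_Integration.integrable_bound[OF integrable_mult_right[OF integrable_std_gauss_id, of B]])
      (auto simp: abs_mult mult.commute intro!: mult_left_mono order_trans[OF bnd(1)])
  have i: "integrable lborel (\<lambda>x. ?d x * f' x)" "integrable lborel (\<lambda>x. ?d x * (x * f x))"
    using i1 i2 by (simp_all add: integrable_std_gauss_iff)
  have "((\<lambda>x. B * ?d x) \<longlongrightarrow> B * 0) at_top" "((\<lambda>x. B * ?d x) \<longlongrightarrow> B * 0) at_bot"
    by (intro tendsto_intros std_normal_density_at_top std_normal_density_at_bot)+
  moreover have "norm (f x * ?d x) \<le> B * ?d x" for x
    using bnd(1)[of x] by (simp add: abs_mult mult_right_mono)
  ultimately have lim: "((\<lambda>x. f x * ?d x) \<longlongrightarrow> 0) at_top" "((\<lambda>x. f x * ?d x) \<longlongrightarrow> 0) at_bot"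
    by (auto intro!: Lim_null_comparison[where g = "\<lambda>x. B * ?d x"] always_eventually)
  have cd: "continuous_on UNIV ?d"
    by (meson DERIV_isCont continuous_at_imp_continuous_on std_normal_density_deriv)
  have "(LBINT x=-\<infinity>..\<infinity>. ?d x * f' x - ?d x * (x * f x)) = 0 - 0"
  proof (rule interval_integral_FTC_integrable)
    show "((\<lambda>x. f x * ?d x) has_vector_derivative ?d x * f' x - ?d x * (x * f x)) (at x)" for x
      using DERIV_mult[OF der std_normal_density_deriv, of x]
      by (simp add: has_real_derivative_iff_has_vector_derivative [symmetric] algebra_simps)
    show "isCont (\<lambda>x. ?d x * f' x - ?d x * (x * f x)) x" for x
    proof -
      have "continuous_on UNIV (\<lambda>x. ?d x * f' x - ?d x * (x * f x))"
        by (intro continuous_intros cont contf cd)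
      then show ?thesis
        by (simp add: continuous_on_eq_continuous_at)
    qed
    show "set_integrable lborel (einterval (-\<infinity>) \<infinity>) (\<lambda>x. ?d x * f' x - ?d x * (x * f x))"
      unfolding set_integrable_def using i by simp
  qed (use lim in \<open>simp_all add: ereal_tendsto_simps\<close>)
  then have "(\<integral>x. ?d x * f' x - ?d x * (x * f x) \<partial>lborel) = 0"
    by (simp add: interval_lebesgue_integral_def set_lebesgue_integral_def)
  then show ?thesis
    using i by (simp add: integral_std_gauss)
qed

lemma integral_PiM_component:
  fixes f :: "real \<Rightarrow> real"
  assumes "i \<in> I" and [measurable]: "f \<in> borel_measurable borel"
  shows "(\<integral>w. f (w i) \<partial>std_gauss_PiM I) = (\<integral>x. f x \<partial>std_gauss)"
proof -
  have "distr (std_gauss_PiM I) std_gauss (\<lambda>w. w i) = std_gauss"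
    using assms by (intro distr_PiM_component prob_space_std_gauss)
  then have "(\<integral>x. f x \<partial>std_gauss) = (\<integral>x. f x \<partial>distr (std_gauss_PiM I) std_gauss (\<lambda>w. w i))"
    by simp
  also have "\<dots> = (\<integral>w. f (w i) \<partial>std_gauss_PiM I)"
    using assms by (subst integral_distr) auto
  finally show ?thesis ..
qed

lemma integrable_PiM_component:
  fixes f :: "real \<Rightarrow> real"
  assumes "i \<in> I" and int: "integrable std_gauss f"
  shows "integrable (std_gauss_PiM I) (\<lambda>w. f (w i))"
proof -
  have "distr (std_gauss_PiM I) std_gauss (\<lambda>w. w i) = std_gauss"
    using assms by (intro distr_PiM_component prob_space_std_gauss)
  then have "integrable (distr (std_gauss_PiM I) std_gauss (\<lambda>w. w i)) f"
    using int by simp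
  then show ?thesis
    using assms(1) int by (subst (asm) integrable_distr_eq) auto
qed

text \<open>By Fubini, coordinate \<open>i\<close> is integrated first with the others frozen; the
  inner integral is the one-dimensional identity. The bounds on \<open>p\<close> and
  \<open>p'\<close> make both integrands integrable, as Fubini requires.\<close>

lemma std_gauss_PiM_by_parts:
  fixes p p' :: "('i \<Rightarrow> real) \<Rightarrow> real"
  assumes I: "finite I" "i \<in> I"
    and [measurable]: "p \<in> borel_measurable (std_gauss_PiM I)" "p' \<in> borel_measurable (std_gauss_PiM I)"
    and bnd: "\<And>w. \<bar>p w\<bar> \<le> B" "\<And>w. \<bar>p' w\<bar> \<le> B'"
    and der: "\<And>w y. ((\<lambda>y. p (w(i := y))) has_real_derivative p' (w(i := y))) (at y)"
    and cont: "\<And>w. continuous_on UNIV (\<lambda>y. p' (w(i := y)))"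
  shows "(\<integral>w. w i * p w \<partial>std_gauss_PiM I) = (\<integral>w. p' w \<partial>std_gauss_PiM I)"
proof -
  define K where "K = I - {i}"
  have K: "finite K" "i \<notin> K" "I = insert i K"
    using I by (auto simp: K_def)
  have 1: "integrable (std_gauss_PiM I) p'"
    by (rule gauss_prod.P.integrable_const_bound[where B = B']) (auto simp: bnd)
  have 2: "integrable (std_gauss_PiM I) (\<lambda>w. w i * p w)"
  proof (rule Bochner_Integration.integrable_bound)
    show "integrable (std_gauss_PiM I) (\<lambda>w. w i * B)"
      by (intro integrable_mult_left integrable_PiM_component integrable_std_gauss_id I)
    show "AE w in std_gauss_PiM I. norm (w i * p w) \<le> norm (w i * B)"
      by (auto simp: abs_mult intro!: mult_left_mono order_trans[OF bnd(1) abs_ge_self])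
  qed (use I in auto)
  have "(\<integral>w. w i * p w \<partial>std_gauss_PiM I) =
    (\<integral>w. (\<integral>y. y * p (w(i := y)) \<partial>std_gauss) \<partial>std_gauss_PiM K)"
    using gauss_prod.product_integral_insert[OF K(1,2) 2[unfolded K(3)]] by (simp add: K(3))
  also have "\<dots> = (\<integral>w. (\<integral>y. p' (w(i := y)) \<partial>std_gauss) \<partial>std_gauss_PiM K)"
    by (intro Bochner_Integration.integral_cong refl std_gauss_by_parts[OF der cont bnd])
  also have "\<dots> = (\<integral>w. p' w \<partial>std_gauss_PiM I)"
    using gauss_prod.product_integral_insert[OF K(1,2) 1[unfolded K(3)]] by (simp add: K(3))
  finally show ?thesis .
qed

text \<open>Differentiation under the integral sign. The mean value inequality bounds every
  difference quotient by \<open>g\<close>, so dominated convergence applies along each sequence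
  tending to \<open>t\<close>.\<close>

lemma has_real_derivative_integral:
  fixes f f' :: "real \<Rightarrow> 'a \<Rightarrow> real"
  assumes int: "\<And>t. integrable M (f t)"
    and der: "\<And>t x. x \<in> space M \<Longrightarrow> ((\<lambda>t. f t x) has_real_derivative f' t x) (at t)"
    and bnd: "\<And>t x. x \<in> space M \<Longrightarrow> \<bar>f' t x\<bar> \<le> g x"
    and g: "integrable M g"
    and [measurable]: "\<And>t. f' t \<in> borel_measurable M"
  shows "((\<lambda>t. \<integral>x. f t x \<partial>M) has_real_derivative (\<integral>x. f' t x \<partial>M)) (at t)"
  unfolding has_field_derivative_iff LIM_def tendsto_at_iff_sequentially comp_def
proof (intro allI impI)
  fix X :: "nat \<Rightarrow> real"
  assume X: "\<forall>n. X n \<in> UNIV - {t}" "X \<longlonglongrightarrow> t"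
  have [measurable]: "f t \<in> borel_measurable M" for t
    using int by auto
  have "(\<lambda>n. \<integral>x. (f (X n) x - f t x) / (X n - t) \<partial>M) \<longlonglongrightarrow> (\<integral>x. f' t x \<partial>M)"
  proof (rule integral_dominated_convergence[where w = g])
    show "AE x in M. (\<lambda>n. (f (X n) x - f t x) / (X n - t)) \<longlonglongrightarrow> f' t x"
    proof (rule AE_I2)
      fix x assume "x \<in> space M"
      from der[OF this, of t] X show "(\<lambda>n. (f (X n) x - f t x) / (X n - t)) \<longlonglongrightarrow> f' t x"
        unfolding has_field_derivative_iff tendsto_at_iff_sequentially comp_def by blast
    qed
    show "AE x in M. norm ((f (X n) x - f t x) / (X n - t)) \<le> g x" for n
    proof (rule AE_I2)
      fix x assume x: "x \<in> space M"
      have "norm (f (X n) x - f t x) \<le> g x * norm (X n - t)"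
        by (rule field_differentiable_bound[of UNIV _ "\<lambda>t. f' t x"]) (use der bnd x in auto)
      then show "norm ((f (X n) x - f t x) / (X n - t)) \<le> g x"
        using X(1) by (simp add: divide_le_eq)
    qed
  qed (use g in auto)
  then show "(\<lambda>n. ((\<integral>x. f (X n) x \<partial>M) - (\<integral>x. f t x \<partial>M)) / (X n - t)) \<longlonglongrightarrow> (\<integral>x. f' t x \<partial>M)"
    using int by simp
qed

section \<open>The Sudakov-Fernique inequality\<close>

definition softmax :: "real \<Rightarrow> 't set \<Rightarrow> ('t \<Rightarrow> real) \<Rightarrow> 't \<Rightarrow> real"
  where "softmax \<beta> T z t = exp (\<beta> * z t) / (\<Sum>s\<in>T. exp (\<beta> * z s))"

text \<open>The free energy at inverse temperature \<open>\<beta>\<close>: a smooth upper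
  approximation of the maximum, exact up to \<open>ln (card T) / \<beta>\<close>, whose gradient is
  the probability vector \<open>softmax\<close>.\<close>

definition lse :: "real \<Rightarrow> 't set \<Rightarrow> ('t \<Rightarrow> real) \<Rightarrow> real"
  where "lse \<beta> T z = ln (\<Sum>t\<in>T. exp (\<beta> * z t)) / \<beta>"

lemma softmax_nonneg: "0 \<le> softmax \<beta> T z t"
  by (simp add: softmax_def sum_nonneg)

lemma sum_exp_pos:
  fixes z :: "'t \<Rightarrow> real"
  shows "finite T \<Longrightarrow> T \<noteq> {} \<Longrightarrow> 0 < (\<Sum>t\<in>T. exp (\<beta> * z t))"
  by (simp add: sum_pos)

lemma sum_softmax: "finite T \<Longrightarrow> T \<noteq> {} \<Longrightarrow> (\<Sum>t\<in>T. softmax \<beta> T z t) = 1"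
  using sum_exp_pos[of T \<beta> z] by (simp add: softmax_def flip: sum_divide_distrib)

lemma softmax_le_1: "finite T \<Longrightarrow> t \<in> T \<Longrightarrow> softmax \<beta> T z t \<le> 1"
  using sum_softmax[of T \<beta> z] member_le_sum[of t T "softmax \<beta> T z"] softmax_nonneg[of \<beta> T z]
  by (metis empty_iff)

lemma Max_le_lse:
  assumes "finite T" "T \<noteq> {}" "\<beta> > 0"
  shows "Max (z ` T) \<le> lse \<beta> T z"
proof -
  have "z t \<le> lse \<beta> T z" if "t \<in> T" for t
  proof -
    have "exp (\<beta> * z t) \<le> (\<Sum>t\<in>T. exp (\<beta> * z t))"
      using assms that by (intro member_le_sum) auto
    then have "\<beta> * z t \<le> ln (\<Sum>t\<in>T. exp (\<beta> * z t))"
      using sum_exp_pos[OF assms(1,2)] by (simp add: ln_ge_iff)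
    then show ?thesis
      using assms by (simp add: lse_def field_simps)
  qed
  then show ?thesis
    using assms by simp
qed

lemma lse_le_Max:
  assumes "finite T" "T \<noteq> {}" "\<beta> > 0"
  shows "lse \<beta> T z \<le> Max (z ` T) + ln (card T) / \<beta>"
proof -
  have "(\<Sum>t\<in>T. exp (\<beta> * z t)) \<le> (\<Sum>t\<in>T. exp (\<beta> * Max (z ` T)))"
    using assms by (intro sum_mono) simp
  then have "ln (\<Sum>t\<in>T. exp (\<beta> * z t)) \<le> ln (card T * exp (\<beta> * Max (z ` T)))"
    using sum_exp_pos[OF assms(1,2), of \<beta> z] by simp
  also have "\<dots> = ln (card T) + \<beta> * Max (z ` T)"
    using assms by (simp add: ln_mult card_gt_0_iff)
  finally show ?thesis
    using assms by (simp add: lse_def field_simps)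
qed

text \<open>Serves as an integrable envelope once the \<open>z t\<close> are linear forms in
  Gaussian variables.\<close>

lemma abs_lse_le:
  assumes "finite T" "T \<noteq> {}" "\<beta> > 0"
  shows "\<bar>lse \<beta> T z\<bar> \<le> (\<Sum>t\<in>T. \<bar>z t\<bar>) + ln (card T) / \<beta>"
proof -
  have "\<bar>Max (z ` T)\<bar> \<le> (\<Sum>t\<in>T. \<bar>z t\<bar>)"
  proof -
    from assms have "Max (z ` T) \<in> z ` T"
      by simp
    then obtain t where "t \<in> T" "Max (z ` T) = z t"
      by auto
    then show ?thesis
      using assms by (simp add: member_le_sum[of t T "\<lambda>t. \<bar>z t\<bar>"])
  qed
  moreover have "0 \<le> ln (card T) / \<beta>"
    using assms by (simp add: Suc_leI card_gt_0_iff)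
  ultimately show ?thesis
    using Max_le_lse[OF assms, of z] lse_le_Max[OF assms, of z] by linarith
qed

lemma has_real_derivative_lse:
  fixes z :: "'t \<Rightarrow> real \<Rightarrow> real"
  assumes "finite T" "T \<noteq> {}" "\<beta> > 0"
    and z: "\<And>t. t \<in> T \<Longrightarrow> (z t has_real_derivative z' t) (at x)"
  shows "((\<lambda>y. lse \<beta> T (\<lambda>t. z t y)) has_real_derivative
    (\<Sum>t\<in>T. softmax \<beta> T (\<lambda>t. z t x) t * z' t)) (at x)"
proof -
  let ?S = "\<Sum>t\<in>T. exp (\<beta> * z t x)"
  have S: "?S > 0"
    by (rule sum_exp_pos[OF assms(1,2)])
  have "((\<lambda>y. lse \<beta> T (\<lambda>t. z t y)) has_real_derivative
      (\<Sum>t\<in>T. exp (\<beta> * z t x) * (\<beta> * z' t)) / ?S / \<beta>) (at x)"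
    unfolding lse_def using S assms(3)
    by (auto intro!: derivative_eq_intros z simp: field_simps)
  moreover have "(\<Sum>t\<in>T. exp (\<beta> * z t x) * (\<beta> * z' t)) / ?S / \<beta> =
      (\<Sum>t\<in>T. softmax \<beta> T (\<lambda>t. z t x) t * z' t)"
    using assms(3) S by (auto simp: softmax_def sum_divide_distrib intro!: sum.cong)
  ultimately show ?thesis
    by simp
qed

text \<open>The logarithmic derivative of a Gibbs weight is \<open>\<beta>\<close> times the
  deviation of \<open>z' t\<close> from its Gibbs mean, the mean coming from the normalizing
  sum.\<close>

lemma has_real_derivative_softmax:
  fixes z :: "'t \<Rightarrow> real \<Rightarrow> real"
  assumes "finite T" "t \<in> T"
    and z: "\<And>t. t \<in> T \<Longrightarrow> (z t has_real_derivative z' t) (at x)"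
  shows "((\<lambda>y. softmax \<beta> T (\<lambda>t. z t y) t) has_real_derivative
    \<beta> * softmax \<beta> T (\<lambda>t. z t x) t * (z' t - (\<Sum>s\<in>T. softmax \<beta> T (\<lambda>t. z t x) s * z' s))) (at x)"
proof -
  let ?S = "\<Sum>t\<in>T. exp (\<beta> * z t x)" and ?e = "exp (\<beta> * z t x)"
  define m where "m = (\<Sum>s\<in>T. softmax \<beta> T (\<lambda>t. z t x) s * z' s)"
  have S: "?S > 0"
    using assms by (intro sum_exp_pos) auto
  have "m = (\<Sum>s\<in>T. exp (\<beta> * z s x) * z' s) / ?S"
    by (simp add: m_def softmax_def sum_divide_distrib)
  moreover have "(\<Sum>s\<in>T. exp (\<beta> * z s x) * (\<beta> * z' s)) = \<beta> * (\<Sum>s\<in>T. exp (\<beta> * z s x) * z' s)"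
    by (simp add: sum_distrib_left mult.left_commute)
  ultimately have m: "(\<Sum>s\<in>T. exp (\<beta> * z s x) * (\<beta> * z' s)) = \<beta> * ?S * m"
    using S by simp
  have "((\<lambda>y. softmax \<beta> T (\<lambda>t. z t y) t) has_real_derivative
      (?e * (\<beta> * z' t) * ?S - ?e * (\<Sum>s\<in>T. exp (\<beta> * z s x) * (\<beta> * z' s))) / (?S * ?S)) (at x)"
    unfolding softmax_def using S assms(2)
    by (auto intro!: derivative_eq_intros z simp: mult_ac)
  moreover have "(?e * (\<beta> * z' t) * ?S - ?e * (\<beta> * ?S * m)) / (?S * ?S) =
      \<beta> * softmax \<beta> T (\<lambda>t. z t x) t * (z' t - m)"
    using S by (simp add: softmax_def divide_simps) (simp add: algebra_simps)
  ultimately show ?thesis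
    unfolding m by (simp add: m_def)
qed

text \<open>Symmetrization in \<open>t\<close> and \<open>s\<close>. Integration by parts produces
  the left-hand side; the right-hand side involves \<open>D\<close> only through the combination
  belonging to the increment between \<open>t\<close> and \<open>s\<close>, which is where the
  hypothesis on increments can enter.\<close>

lemma weighted_increments:
  fixes p :: "'t \<Rightarrow> real"
  assumes "sum p T = 1"
  shows "2 * (\<Sum>t\<in>T. p t * (D t t - (\<Sum>s\<in>T. p s * D t s))) =
    (\<Sum>t\<in>T. \<Sum>s\<in>T. p t * p s * (D t t + D s s - D t s - D s t))"
proof -
  have 1: "(\<Sum>t\<in>T. \<Sum>s\<in>T. p t * p s * D t t) = (\<Sum>t\<in>T. p t * D t t)"
  proof (rule sum.cong[OF refl])
    fix t
    have "(\<Sum>s\<in>T. p t * p s * D t t) = p t * D t t * sum p T"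
      by (simp add: sum_distrib_left mult_ac)
    then show "(\<Sum>s\<in>T. p t * p s * D t t) = p t * D t t"
      using assms by simp
  qed
  have 2: "(\<Sum>t\<in>T. \<Sum>s\<in>T. p t * p s * D s s) = (\<Sum>t\<in>T. p t * D t t)"
    by (subst sum.swap) (use 1 in \<open>simp add: mult_ac\<close>)
  have 3: "(\<Sum>t\<in>T. \<Sum>s\<in>T. p t * p s * D s t) = (\<Sum>t\<in>T. \<Sum>s\<in>T. p t * p s * D t s)"
    by (subst sum.swap) (simp add: mult_ac)
  have "(\<Sum>t\<in>T. p t * (D t t - (\<Sum>s\<in>T. p s * D t s))) =
      (\<Sum>t\<in>T. p t * D t t) - (\<Sum>t\<in>T. \<Sum>s\<in>T. p t * p s * D t s)"
    by (simp add: right_diff_distrib sum_subtractf sum_distrib_left mult.assoc)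
  moreover have "(\<Sum>t\<in>T. \<Sum>s\<in>T. p t * p s * (D t t + D s s - D t s - D s t)) =
      2 * (\<Sum>t\<in>T. p t * D t t) - 2 * (\<Sum>t\<in>T. \<Sum>s\<in>T. p t * p s * D t s)"
    using 1 2 3 by (simp add: distrib_left right_diff_distrib sum.distrib sum_subtractf)
  ultimately show ?thesis
    by simp
qed

lemma has_real_derivative_sum_fun_upd:
  fixes c w :: "'i \<Rightarrow> real"
  assumes "finite I" "i \<in> I"
  shows "((\<lambda>y. \<Sum>j\<in>I. c j * (w(i := y)) j) has_real_derivative c i) (at y)"
proof -
  have "(\<lambda>y. \<Sum>j\<in>I. c j * (w(i := y)) j) = (\<lambda>y. c i * y + (\<Sum>j\<in>I - {i}. c j * w j))"
    using assms by (auto simp: sum.remove fun_eq_iff intro!: sum.cong)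
  then show ?thesis
    by (auto intro!: derivative_eq_intros)
qed

section \<open>Measurability and integrability of maxima, soft maxima and linear forms\<close>

lemma integrable_Max:
  fixes f :: "'t \<Rightarrow> 'a \<Rightarrow> real"
  assumes "finite T" "T \<noteq> {}" "\<And>t. t \<in> T \<Longrightarrow> integrable M (f t)"
  shows "integrable M (\<lambda>x. Max ((\<lambda>t. f t x) ` T))"
  using assms
proof (induction T rule: finite_ne_induct)
  case (insert t T)
  have "Max ((\<lambda>t. f t x) ` insert t T) = max (f t x) (Max ((\<lambda>t. f t x) ` T))" for x
    using insert by simp
  then show ?case
    using insert by simp
qed simp

lemma borel_measurable_softmax:
  fixes z :: "'t \<Rightarrow> 'a \<Rightarrow> real"
  assumes [measurable]: "\<And>t. z t \<in> borel_measurable M"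
  shows "(\<lambda>x. softmax \<beta> T (\<lambda>t. z t x) t) \<in> borel_measurable M"
  unfolding softmax_def by measurable

lemma borel_measurable_lse:
  fixes z :: "'t \<Rightarrow> 'a \<Rightarrow> real"
  assumes [measurable]: "\<And>t. z t \<in> borel_measurable M"
  shows "(\<lambda>x. lse \<beta> T (\<lambda>t. z t x)) \<in> borel_measurable M"
  unfolding lse_def by measurable

lemma borel_measurable_linear_form [measurable]:
  fixes c :: "'i \<Rightarrow> real"
  shows "(\<lambda>w. \<Sum>i\<in>I. c i * w i) \<in> borel_measurable (std_gauss_PiM I)"
proof (rule borel_measurable_sum)
  fix i assume [measurable]: "i \<in> I"
  show "(\<lambda>w. c i * w i) \<in> borel_measurable (std_gauss_PiM I)"
    by measurable
qed

lemma integrable_linear_form: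
  fixes c :: "'i \<Rightarrow> real"
  shows "integrable (std_gauss_PiM I) (\<lambda>w. \<Sum>i\<in>I. c i * w i)"
  by (intro Bochner_Integration.integrable_sum integrable_mult_right integrable_PiM_component
      integrable_std_gauss_id)

lemma integrable_lse_linear_form:
  fixes c :: "'t \<Rightarrow> 'i \<Rightarrow> real"
  assumes "finite T" "T \<noteq> {}" "\<beta> > 0"
  shows "integrable (std_gauss_PiM I) (\<lambda>w. lse \<beta> T (\<lambda>t. \<Sum>i\<in>I. c t i * w i))"
proof (rule Bochner_Integration.integrable_bound)
  show "integrable (std_gauss_PiM I) (\<lambda>w. (\<Sum>t\<in>T. \<bar>\<Sum>i\<in>I. c t i * w i\<bar>) + ln (card T) / \<beta>)"
    by (intro Bochner_Integration.integrable_add Bochner_Integration.integrable_sum integrable_abs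
        integrable_linear_form) simp
  show "(\<lambda>w. lse \<beta> T (\<lambda>t. \<Sum>i\<in>I. c t i * w i)) \<in> borel_measurable (std_gauss_PiM I)"
    by (intro borel_measurable_lse borel_measurable_linear_form)
  show "AE w in std_gauss_PiM I. norm (lse \<beta> T (\<lambda>t. \<Sum>i\<in>I. c t i * w i))
      \<le> norm ((\<Sum>t\<in>T. \<bar>\<Sum>i\<in>I. c t i * w i\<bar>) + ln (card T) / \<beta>)"
    by (intro AE_I2) (use abs_lse_le[OF assms] in \<open>simp add: order_trans[OF _ abs_ge_self]\<close>)
qed

section \<open>Interpolation between two Gaussian families\<close>

text \<open>Integration by parts applied to a Gibbs weight of linear forms. Weights lie in [0, 1],
  so the weight and its partial derivative in \<open>w i\<close> are bounded, as that identity
  demands.\<close>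

lemma integral_coordinate_mult_softmax:
  fixes c :: "'t \<Rightarrow> 'i \<Rightarrow> real" and \<beta> :: real
  assumes I: "finite I" "i \<in> I" and T: "finite T" "t \<in> T"
  defines "p \<equiv> \<lambda>w. softmax \<beta> T (\<lambda>s. \<Sum>j\<in>I. c s j * w j)"
  shows "(\<integral>w. w i * p w t \<partial>std_gauss_PiM I) =
      (\<integral>w. \<beta> * p w t * (c t i - (\<Sum>s\<in>T. p w s * c s i)) \<partial>std_gauss_PiM I)"
proof (rule std_gauss_PiM_by_parts[OF I])
  have pm [measurable]: "(\<lambda>w. p w s) \<in> borel_measurable (std_gauss_PiM I)" for s
    unfolding p_def by (intro borel_measurable_softmax borel_measurable_linear_form)
  show "(\<lambda>w. p w t) \<in> borel_measurable (std_gauss_PiM I)"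
    "(\<lambda>w. \<beta> * p w t * (c t i - (\<Sum>s\<in>T. p w s * c s i))) \<in> borel_measurable (std_gauss_PiM I)"
    by measurable
  have p01: "0 \<le> p w s" "s \<in> T \<Longrightarrow> p w s \<le> 1" for w s
    using T by (auto simp: p_def softmax_nonneg softmax_le_1)
  then show "\<bar>p w t\<bar> \<le> 1" for w
    using T by auto
  show "\<bar>\<beta> * p w t * (c t i - (\<Sum>s\<in>T. p w s * c s i))\<bar> \<le> \<bar>\<beta>\<bar> * 1 * (\<bar>c t i\<bar> + (\<Sum>s\<in>T. 1 * \<bar>c s i\<bar>))" for w
    unfolding abs_mult using p01 T(2)
    by (intro mult_mono order_trans[OF abs_triangle_ineq4] add_mono order_trans[OF sum_abs] sum_mono)
      (auto simp: abs_mult mult_left_le_one_le)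
  show der: "((\<lambda>y. p (w(i := y)) t) has_real_derivative
      \<beta> * p (w(i := y)) t * (c t i - (\<Sum>s\<in>T. p (w(i := y)) s * c s i))) (at y)" for w y
    unfolding p_def by (intro has_real_derivative_softmax T has_real_derivative_sum_fun_upd I)
  have "continuous_on UNIV (\<lambda>y. p (w(i := y)) s)" if "s \<in> T" for w s
    unfolding p_def
    by (rule DERIV_continuous_on, rule has_real_derivative_softmax[OF T(1) that],
      rule has_real_derivative_sum_fun_upd[OF I])
  then show "continuous_on UNIV (\<lambda>y. \<beta> * p (w(i := y)) t * (c t i - (\<Sum>s\<in>T. p (w(i := y)) s * c s i)))" for w
    using T by (intro continuous_intros) auto
qed

text \<open>The coefficients are rotated from \<open>a\<close> to \<open>b\<close> by an angle
  running from 0 to \<open>pi / 2\<close>. After integration by parts, the derivative of the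
  expected soft maximum is a nonnegatively weighted sum of differences between the increment
  variances of \<open>b\<close> and of \<open>a\<close>. Orthogonality says that the two families
  are uncorrelated, which removes the mixed term.\<close>

lemma sudakov_fernique_lse:
  fixes a b :: "'t \<Rightarrow> 'i \<Rightarrow> real"
  assumes T: "finite T" "T \<noteq> {}" and I: "finite I" and \<beta>: "\<beta> > 0"
    and orth: "\<And>s t. s \<in> T \<Longrightarrow> t \<in> T \<Longrightarrow> (\<Sum>i\<in>I. a s i * b t i) = 0"
    and incr: "\<And>s t. s \<in> T \<Longrightarrow> t \<in> T \<Longrightarrow> (\<Sum>i\<in>I. (a t i - a s i)\<^sup>2) \<le> (\<Sum>i\<in>I. (b t i - b s i)\<^sup>2)"
  shows "(\<integral>w. lse \<beta> T (\<lambda>t. \<Sum>i\<in>I. a t i * w i) \<partial>std_gauss_PiM I) \<le>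
    (\<integral>w. lse \<beta> T (\<lambda>t. \<Sum>i\<in>I. b t i * w i) \<partial>std_gauss_PiM I)"
proof -
  define c where "c \<theta> t i = cos \<theta> * a t i + sin \<theta> * b t i" for \<theta> t i
  define c' where "c' \<theta> t i = - sin \<theta> * a t i + cos \<theta> * b t i" for \<theta> t i
  define p where "p \<theta> w = softmax \<beta> T (\<lambda>t. \<Sum>i\<in>I. c \<theta> t i * w i)" for \<theta> w
  define \<psi> where "\<psi> \<theta> = (\<integral>w. lse \<beta> T (\<lambda>t. \<Sum>i\<in>I. c \<theta> t i * w i) \<partial>std_gauss_PiM I)" for \<theta>
  define \<psi>' where "\<psi>' \<theta> = (\<integral>w. (\<Sum>t\<in>T. p \<theta> w t * (\<Sum>i\<in>I. c' \<theta> t i * w i)) \<partial>std_gauss_PiM I)" for \<theta>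
  have pm [measurable]: "(\<lambda>w. p \<theta> w s) \<in> borel_measurable (std_gauss_PiM I)" for s \<theta>
    unfolding p_def by (intro borel_measurable_softmax borel_measurable_linear_form)
  have p01: "0 \<le> p \<theta> w s" "s \<in> T \<Longrightarrow> p \<theta> w s \<le> 1" "sum (p \<theta> w) T = 1" for \<theta> w s
    using T by (auto simp: p_def softmax_nonneg softmax_le_1 sum_softmax)
  have der: "(\<psi> has_real_derivative \<psi>' \<theta>) (at \<theta>)" for \<theta>
    unfolding \<psi>_def \<psi>'_def
  proof (rule has_real_derivative_integral)
    show "integrable (std_gauss_PiM I) (\<lambda>w. lse \<beta> T (\<lambda>t. \<Sum>i\<in>I. c \<theta> t i * w i))" for \<theta>
      by (rule integrable_lse_linear_form[OF T \<beta>])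
    show "((\<lambda>\<theta>. lse \<beta> T (\<lambda>t. \<Sum>i\<in>I. c \<theta> t i * w i)) has_real_derivative
        (\<Sum>t\<in>T. p \<theta> w t * (\<Sum>i\<in>I. c' \<theta> t i * w i))) (at \<theta>)" for \<theta> w
      unfolding p_def
    proof (rule has_real_derivative_lse[OF T \<beta>])
      show "((\<lambda>\<theta>. \<Sum>i\<in>I. c \<theta> t i * w i) has_real_derivative (\<Sum>i\<in>I. c' \<theta> t i * w i)) (at \<theta>)" for t
        unfolding c_def c'_def by (auto intro!: derivative_eq_intros sum.cong simp: algebra_simps)
    qed
    \<comment> \<open>An envelope independent of the angle: weights, sines and cosines are all at
      most 1 in absolute value.\<close>
    show "integrable (std_gauss_PiM I) (\<lambda>w. \<Sum>t\<in>T. 1 * (\<Sum>i\<in>I. (\<bar>a t i\<bar> + \<bar>b t i\<bar>) * \<bar>w i\<bar>))"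
      by (intro Bochner_Integration.integrable_sum integrable_mult_right integrable_abs
          integrable_PiM_component integrable_std_gauss_id)
    show "\<bar>\<Sum>t\<in>T. p \<theta> w t * (\<Sum>i\<in>I. c' \<theta> t i * w i)\<bar>
        \<le> (\<Sum>t\<in>T. 1 * (\<Sum>i\<in>I. (\<bar>a t i\<bar> + \<bar>b t i\<bar>) * \<bar>w i\<bar>))" for \<theta> w
    proof (rule order_trans[OF sum_abs], rule sum_mono)
      fix t assume t: "t \<in> T"
      have "\<bar>c' \<theta> t i\<bar> \<le> \<bar>a t i\<bar> + \<bar>b t i\<bar>" for i
      proof -
        have "\<bar>sin \<theta>\<bar> * \<bar>a t i\<bar> \<le> 1 * \<bar>a t i\<bar>" "\<bar>cos \<theta>\<bar> * \<bar>b t i\<bar> \<le> 1 * \<bar>b t i\<bar>"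
          by (intro mult_right_mono; simp)+
        then show ?thesis
          using abs_triangle_ineq[of "- sin \<theta> * a t i" "cos \<theta> * b t i"]
          unfolding c'_def abs_mult abs_minus_cancel by linarith
      qed
      then have "\<bar>\<Sum>i\<in>I. c' \<theta> t i * w i\<bar> \<le> (\<Sum>i\<in>I. (\<bar>a t i\<bar> + \<bar>b t i\<bar>) * \<bar>w i\<bar>)"
        by (intro order_trans[OF sum_abs] sum_mono) (auto simp: abs_mult intro!: mult_right_mono)
      then show "\<bar>p \<theta> w t * (\<Sum>i\<in>I. c' \<theta> t i * w i)\<bar> \<le> 1 * (\<Sum>i\<in>I. (\<bar>a t i\<bar> + \<bar>b t i\<bar>) * \<bar>w i\<bar>)"
        unfolding abs_mult using p01 t by (intro mult_mono) auto
    qed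
    show "(\<lambda>w. \<Sum>t\<in>T. p \<theta> w t * (\<Sum>i\<in>I. c' \<theta> t i * w i)) \<in> borel_measurable (std_gauss_PiM I)" for \<theta>
      by measurable
  qed
  have nonneg: "0 \<le> \<psi>' \<theta>" if \<theta>: "0 \<le> \<theta>" "\<theta> \<le> pi / 2" for \<theta>
  proof -
    \<comment> \<open>The covariance of the angular derivative of the process at \<open>t\<close>
      with the process itself at \<open>s\<close>.\<close>
    define D where "D t s = (\<Sum>i\<in>I. c' \<theta> t i * c \<theta> s i)" for t s
    \<comment> \<open>The partial derivative of the weight of \<open>t\<close> with respect to
      \<open>w i\<close>; it replaces \<open>w i * p \<theta> w t\<close> under the
      integral.\<close>
    let ?q = "\<lambda>w t i. \<beta> * p \<theta> w t * (c \<theta> t i - (\<Sum>s\<in>T. p \<theta> w s * c \<theta> s i))"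
    have int1: "integrable (std_gauss_PiM I) (\<lambda>w. w i * p \<theta> w t)" if "i \<in> I" "t \<in> T" for i t
    proof (rule Bochner_Integration.integrable_bound)
      show "integrable (std_gauss_PiM I) (\<lambda>w. w i)"
        by (intro integrable_PiM_component integrable_std_gauss_id that)
      show "AE w in std_gauss_PiM I. norm (w i * p \<theta> w t) \<le> norm (w i)"
        using p01 that by (auto simp: abs_mult mult_left_le)
    qed (use that in measurable)
    have int2: "integrable (std_gauss_PiM I) (\<lambda>w. ?q w t i)" if "t \<in> T" for t i
    proof (rule gauss_prod.P.integrable_const_bound)
      show "AE w in std_gauss_PiM I. norm (?q w t i) \<le> \<beta> * 1 * (\<bar>c \<theta> t i\<bar> + (\<Sum>s\<in>T. 1 * \<bar>c \<theta> s i\<bar>))"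
        unfolding real_norm_def abs_mult using p01 that \<beta>
        by (intro AE_I2 mult_mono order_trans[OF abs_triangle_ineq4] add_mono order_trans[OF sum_abs] sum_mono)
          (auto simp: abs_mult mult_left_le_one_le)
    qed measurable
    have "\<psi>' \<theta> = (\<integral>w. (\<Sum>t\<in>T. \<Sum>i\<in>I. c' \<theta> t i * (w i * p \<theta> w t)) \<partial>std_gauss_PiM I)"
      unfolding \<psi>'_def by (simp add: sum_distrib_left mult_ac)
    also have "\<dots> = (\<Sum>t\<in>T. \<Sum>i\<in>I. c' \<theta> t i * (\<integral>w. w i * p \<theta> w t \<partial>std_gauss_PiM I))"
      using int1 by (simp add: Bochner_Integration.integral_sum)
    also have "\<dots> = (\<Sum>t\<in>T. \<Sum>i\<in>I. c' \<theta> t i * (\<integral>w. ?q w t i \<partial>std_gauss_PiM I))"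
      unfolding p_def
      by (intro sum.cong refl arg_cong2[of _ _ _ _ "(*)"] integral_coordinate_mult_softmax I T)
    also have "\<dots> = (\<integral>w. (\<Sum>t\<in>T. \<Sum>i\<in>I. c' \<theta> t i * ?q w t i) \<partial>std_gauss_PiM I)"
      using int2 by (subst Bochner_Integration.integral_sum) (auto simp: Bochner_Integration.integral_sum)
    also have "\<dots> \<ge> 0"
    proof (rule Bochner_Integration.integral_nonneg)
      fix w
      have "(\<Sum>i\<in>I. c' \<theta> t i * ?q w t i) = \<beta> * (p \<theta> w t * (D t t - (\<Sum>s\<in>T. p \<theta> w s * D t s)))" for t
      proof -
        have "(\<Sum>s\<in>T. p \<theta> w s * D t s) = (\<Sum>i\<in>I. c' \<theta> t i * (\<Sum>s\<in>T. p \<theta> w s * c \<theta> s i))"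
          unfolding D_def sum_distrib_left by (subst sum.swap) (simp add: mult_ac)
        then have "D t t - (\<Sum>s\<in>T. p \<theta> w s * D t s) =
            (\<Sum>i\<in>I. c' \<theta> t i * (c \<theta> t i - (\<Sum>s\<in>T. p \<theta> w s * c \<theta> s i)))"
          by (simp add: D_def right_diff_distrib sum_subtractf)
        then show ?thesis
          by (simp add: sum_distrib_left mult_ac)
      qed
      then have "(\<Sum>t\<in>T. \<Sum>i\<in>I. c' \<theta> t i * ?q w t i) =
          \<beta> * (\<Sum>t\<in>T. p \<theta> w t * (D t t - (\<Sum>s\<in>T. p \<theta> w s * D t s)))"
        by (simp add: sum_distrib_left)
      also have "\<dots> = \<beta> / 2 * (\<Sum>t\<in>T. \<Sum>s\<in>T. p \<theta> w t * p \<theta> w s * (D t t + D s s - D t s - D s t))"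
        using weighted_increments[of "p \<theta> w" T D] p01(3) by simp
      also have "\<dots> \<ge> 0"
      proof (intro mult_nonneg_nonneg sum_nonneg p01)
        fix s t assume st: "t \<in> T" "s \<in> T"
        let ?A = "\<lambda>i. a t i - a s i" and ?B = "\<lambda>i. b t i - b s i"
        have "(\<Sum>i\<in>I. ?A i * ?B i) = 0"
          using orth st by (simp add: algebra_simps sum.distrib sum_subtractf)
        \<comment> \<open>This combination is half the angular derivative of the variance of the
          increment between \<open>t\<close> and \<open>s\<close>. The angle stays in the first
          quadrant, so \<open>sin \<theta> * cos \<theta>\<close> is nonnegative.\<close>
        moreover have "D t t + D s s - D t s - D s t =
            sin \<theta> * cos \<theta> * ((\<Sum>i\<in>I. (?B i)\<^sup>2) - (\<Sum>i\<in>I. (?A i)\<^sup>2)) + ((cos \<theta>)\<^sup>2 - (sin \<theta>)\<^sup>2) * (\<Sum>i\<in>I. ?A i * ?B i)"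
          unfolding D_def sum_distrib_left sum.distrib[symmetric] sum_subtractf[symmetric] c_def c'_def
          by (intro sum.cong refl) (simp add: algebra_simps power2_eq_square)
        moreover have "0 \<le> sin \<theta> * cos \<theta>"
          using \<theta> by (intro mult_nonneg_nonneg sin_ge_zero cos_ge_zero) auto
        ultimately show "0 \<le> D t t + D s s - D t s - D s t"
          using incr[OF st(2,1)] by simp
      qed (use \<beta> in auto)
      finally show "0 \<le> (\<Sum>t\<in>T. \<Sum>i\<in>I. c' \<theta> t i * ?q w t i)" .
    qed
    finally show ?thesis .
  qed
  have "\<psi> 0 \<le> \<psi> (pi / 2)"
  proof (rule DERIV_nonneg_imp_nondecreasing[of 0 "pi / 2" \<psi>])
    fix \<theta> :: real assume "0 \<le> \<theta>" "\<theta> \<le> pi / 2"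
    then show "\<exists>y. (\<psi> has_real_derivative y) (at \<theta>) \<and> 0 \<le> y"
      using der nonneg by blast
  qed simp
  then show ?thesis
    by (simp add: \<psi>_def c_def)
qed

text \<open>The soft maximum lies between the maximum and the maximum plus
  \<open>ln (card T) / \<beta>\<close>, so the comparison carries over up to an error that a large
  \<open>\<beta>\<close> makes arbitrarily small.\<close>

lemma sudakov_fernique:
  fixes a b :: "'t \<Rightarrow> 'i \<Rightarrow> real"
  assumes T: "finite T" "T \<noteq> {}" and I: "finite I"
    and orth: "\<And>s t. s \<in> T \<Longrightarrow> t \<in> T \<Longrightarrow> (\<Sum>i\<in>I. a s i * b t i) = 0"
    and incr: "\<And>s t. s \<in> T \<Longrightarrow> t \<in> T \<Longrightarrow> (\<Sum>i\<in>I. (a t i - a s i)\<^sup>2) \<le> (\<Sum>i\<in>I. (b t i - b s i)\<^sup>2)"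
  shows "(\<integral>w. Max ((\<lambda>t. \<Sum>i\<in>I. a t i * w i) ` T) \<partial>std_gauss_PiM I) \<le>
    (\<integral>w. Max ((\<lambda>t. \<Sum>i\<in>I. b t i * w i) ` T) \<partial>std_gauss_PiM I)"
    (is "?a \<le> ?b")
proof (rule field_le_epsilon)
  fix e :: real assume e: "e > 0"
  \<comment> \<open>The added 1 keeps \<open>\<beta>\<close> positive when \<open>T\<close> is a
    singleton and the logarithm vanishes.\<close>
  define \<beta> where "\<beta> = (ln (card T) + 1) / e"
  have L: "0 \<le> ln (card T)"
    using T by (simp add: Suc_leI card_gt_0_iff)
  then have \<beta>: "\<beta> > 0" "ln (card T) / \<beta> \<le> e"
    using e by (auto simp: \<beta>_def field_simps)
  have Mi: "integrable (std_gauss_PiM I) (\<lambda>w. Max ((\<lambda>t. \<Sum>i\<in>I. c t i * w i) ` T))" for c :: "'t \<Rightarrow> 'i \<Rightarrow> real"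
    by (intro integrable_Max T integrable_linear_form)
  have "?a \<le> (\<integral>w. lse \<beta> T (\<lambda>t. \<Sum>i\<in>I. a t i * w i) \<partial>std_gauss_PiM I)"
    by (intro integral_mono Mi integrable_lse_linear_form Max_le_lse T \<beta>)
  also have "\<dots> \<le> (\<integral>w. lse \<beta> T (\<lambda>t. \<Sum>i\<in>I. b t i * w i) \<partial>std_gauss_PiM I)"
    by (rule sudakov_fernique_lse[OF T I \<beta>(1) orth incr])
  also have "\<dots> \<le> (\<integral>w. Max ((\<lambda>t. \<Sum>i\<in>I. b t i * w i) ` T) + ln (card T) / \<beta> \<partial>std_gauss_PiM I)"
    by (intro integral_mono Mi integrable_lse_linear_form lse_le_Max T \<beta> Bochner_Integration.integrable_add) simp
  also have "\<dots> = ?b + ln (card T) / \<beta>"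
    using Mi[of b] by (simp add: gauss_prod.P.prob_space)
  finally show "?a \<le> ?b + e"
    using \<beta>(2) by simp
qed

section \<open>Truncated Gaussian moments\<close>

text \<open>An explicit antiderivative on \<open>{0..q}\<close>, doubled by evenness. The exponent
  is a successor because a zeroth power would equal 1 outside the tent too and not be
  integrable.\<close>

lemma has_bochner_integral_tent:
  fixes q :: real
  assumes "0 \<le> q"
  shows "has_bochner_integral lborel (\<lambda>x. (max 0 (q - \<bar>x\<bar>)) ^ Suc n) (2 * q ^ (n + 2) / (n + 2))"
proof -
  have "has_bochner_integral lborel (\<lambda>x. (q - x) ^ Suc n * indicator {0..q} x)
      (- ((q - q) ^ (n + 2) / (n + 2)) - - ((q - 0) ^ (n + 2) / (n + 2)))"
  proof (rule has_bochner_integral_FTC_Icc_nonneg)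
    show "((\<lambda>x. - ((q - x) ^ (n + 2) / (n + 2))) has_real_derivative (q - x) ^ Suc n) (at x)" for x
    proof -
      have "((\<lambda>x. (q - x) ^ (n + 2)) has_real_derivative real (n + 2) * (- 1 * (q - x) ^ (n + 2 - Suc 0))) (at x)"
        by (rule DERIV_power) (auto intro!: derivative_eq_intros)
      from DERIV_minus[OF DERIV_cdivide[OF this, of "real (n + 2)"]] show ?thesis
        by simp
    qed
  qed (use assms in auto)
  then have "has_bochner_integral lborel (\<lambda>x. (q - x) ^ Suc n * indicator {0..q} x) (q ^ (n + 2) / (n + 2))"
    by simp
  moreover have "(\<lambda>x. (q - x) ^ Suc n * indicator {0..q} x) =
      (\<lambda>x. indicator {0..} x *\<^sub>R (max 0 (q - \<bar>x\<bar>)) ^ Suc n)"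
    by (auto simp: fun_eq_iff max_def split: split_indicator)
  ultimately have "has_bochner_integral lborel (\<lambda>x. (max 0 (q - \<bar>x\<bar>)) ^ Suc n) (2 *\<^sub>R (q ^ (n + 2) / (n + 2)))"
    by (intro has_bochner_integral_even_function) simp_all
  then show ?thesis
    by simp
qed

text \<open>The normal density is replaced by its maximum, attained at 0; little is lost for small
  \<open>q\<close>. That maximum is written as \<open>sqrt (2 / pi) / 2\<close> so that only the
  constant \<open>sqrt (2 / pi)\<close>, the absolute first moment, has to be estimated
  later.\<close>

lemma integral_std_gauss_tent_le:
  fixes q :: real
  assumes "0 \<le> q"
  shows "(\<integral>x. (max 0 (q - \<bar>x\<bar>)) ^ Suc n \<partial>std_gauss) \<le> sqrt (2 / pi) / 2 * (2 * q ^ (n + 2) / (n + 2))"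
proof -
  have tent: "integrable lborel (\<lambda>x. (max 0 (q - \<bar>x\<bar>)) ^ Suc n)"
    "(\<integral>x. (max 0 (q - \<bar>x\<bar>)) ^ Suc n \<partial>lborel) = 2 * q ^ (n + 2) / (n + 2)"
    using has_bochner_integral_tent[OF assms, of n] by (auto simp: has_bochner_integral_iff)
  have density: "std_normal_density x \<le> sqrt (2 / pi) / 2" for x
  proof -
    have "std_normal_density x \<le> 1 / sqrt (2 * pi) * 1"
      unfolding std_normal_density_def by (intro mult_left_mono) auto
    also have "\<dots> = sqrt (2 / pi) / 2"
      by (simp add: real_sqrt_mult real_sqrt_divide field_simps)
    finally show ?thesis .
  qed
  have int: "integrable lborel (\<lambda>x. std_normal_density x * (max 0 (q - \<bar>x\<bar>)) ^ Suc n)"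
  proof (rule Bochner_Integration.integrable_bound)
    show "integrable lborel (\<lambda>x. sqrt (2 / pi) / 2 * (max 0 (q - \<bar>x\<bar>)) ^ Suc n)"
      by (intro integrable_mult_right tent)
    show "AE x in lborel. norm (std_normal_density x * (max 0 (q - \<bar>x\<bar>)) ^ Suc n)
        \<le> norm (sqrt (2 / pi) / 2 * (max 0 (q - \<bar>x\<bar>)) ^ Suc n)"
      using mult_right_mono[OF density, of "(max 0 (q - \<bar>_\<bar>)) ^ Suc n"]
      by (intro AE_I2) (simp add: abs_mult del: power_Suc)
  qed measurable
  have "(\<integral>x. (max 0 (q - \<bar>x\<bar>)) ^ Suc n \<partial>std_gauss) =
      (\<integral>x. std_normal_density x * (max 0 (q - \<bar>x\<bar>)) ^ Suc n \<partial>lborel)"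
    by (rule integral_std_gauss) measurable
  also have "\<dots> \<le> (\<integral>x. sqrt (2 / pi) / 2 * (max 0 (q - \<bar>x\<bar>)) ^ Suc n \<partial>lborel)"
    by (intro integral_mono int integrable_mult_right tent mult_right_mono density) simp
  finally show ?thesis
    unfolding integral_mult_right_zero tent(2) .
qed

lemma integral_std_gauss_reflect:
  fixes f :: "real \<Rightarrow> real"
  assumes [measurable]: "f \<in> borel_measurable borel"
  shows "(\<integral>x. f (- x) \<partial>std_gauss) = (\<integral>x. f x \<partial>std_gauss)"
proof -
  have "(\<integral>x. std_normal_density x * f x \<partial>lborel) =
      (\<integral>x. std_normal_density (- x) * f (- x) \<partial>lborel)"
    using lborel_integral_real_affine[of "-1" "\<lambda>x. std_normal_density x * f x" 0] by simp
  also have "\<dots> = (\<integral>x. std_normal_density x * f (- x) \<partial>lborel)"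
    by (simp add: std_normal_density_def)
  finally show ?thesis
    by (simp add: integral_std_gauss)
qed

lemma integral_std_gauss_abs: "(\<integral>x. \<bar>x\<bar> \<partial>std_gauss) = sqrt (2 / pi)"
  using integral_std_normal_moment_abs_odd[of 0] by (simp add: integral_std_gauss)

lemma integrable_std_gauss_le_square:
  fixes f :: "real \<Rightarrow> real"
  assumes [measurable]: "f \<in> borel_measurable borel" and "\<And>x. \<bar>f x\<bar> \<le> C + D * x\<^sup>2"
  shows "integrable std_gauss f"
proof (rule Bochner_Integration.integrable_bound)
  show "integrable std_gauss (\<lambda>x. C + D * x\<^sup>2)"
    by (intro Bochner_Integration.integrable_add integrable_mult_right integrable_std_gauss_power) simp
qed (use assms(2) order_trans[OF _ abs_ge_self] in auto)

lemma relu_square_le: "(max 0 (x + q))\<^sup>2 \<le> 2 * q\<^sup>2 + 2 * x\<^sup>2" for x q :: real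
proof -
  have "(max 0 (x + q))\<^sup>2 \<le> (x + q)\<^sup>2"
    by (simp add: max_def)
  also have "\<dots> \<le> 2 * q\<^sup>2 + 2 * x\<^sup>2"
    using sum_squares_bound[of x q] unfolding power2_sum by linarith
  finally show ?thesis .
qed

lemma relu_le: "max 0 (x + q) \<le> (1 + 2 * q\<^sup>2) + 2 * x\<^sup>2" for x q :: real
proof -
  have "m \<le> 1 + m\<^sup>2" if "0 \<le> m" for m :: real
    using sum_squares_bound[of 1 m] that by simp
  from this[of "max 0 (x + q)"] show ?thesis
    using relu_square_le[of x q] by simp
qed

lemma integrable_std_gauss_relu:
  "integrable std_gauss (\<lambda>x. max 0 (x + q))" "integrable std_gauss (\<lambda>x. max 0 (- x + q))"
  by (rule integrable_std_gauss_le_square[where C = "1 + 2 * q\<^sup>2" and D = 2];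
      use relu_le[of _ q] relu_le[of "- _" q] in simp)+

lemma integrable_std_gauss_relu_square:
  "integrable std_gauss (\<lambda>x. (max 0 (x + q))\<^sup>2)" "integrable std_gauss (\<lambda>x. (max 0 (- x + q))\<^sup>2)"
  by (rule integrable_std_gauss_le_square[where C = "2 * q\<^sup>2" and D = 2];
      use relu_square_le[of _ q] relu_square_le[of "- _" q] in simp)+

lemma integrable_std_gauss_abs: "integrable std_gauss (\<lambda>x. \<bar>x\<bar>)"
  using integrable_std_gauss_id by (rule integrable_abs)

lemma integrable_std_gauss_tent: "integrable std_gauss (\<lambda>x. (max 0 (q - \<bar>x\<bar>)) ^ n)" for q :: real
proof (rule std_gauss.integrable_const_bound)
  show "AE x in std_gauss. norm ((max 0 (q - \<bar>x\<bar>)) ^ n) \<le> (max 0 q) ^ n"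
    by (intro AE_I2) (auto intro!: power_mono)
qed simp

lemma integral_std_gauss_relu_le:
  assumes q: "0 \<le> q"
  shows "(\<integral>x. max 0 (x + q) \<partial>std_gauss) \<le> (sqrt (2 / pi) * (1 + q\<^sup>2 / 2) + q) / 2"
proof -
  have "2 * (\<integral>x. max 0 (x + q) \<partial>std_gauss) =
      (\<integral>x. max 0 (x + q) \<partial>std_gauss) + (\<integral>x. max 0 (- x + q) \<partial>std_gauss)"
    using integral_std_gauss_reflect[of "\<lambda>x. max 0 (x + q)"] by simp
  also have "\<dots> = (\<integral>x. max 0 (x + q) + max 0 (- x + q) \<partial>std_gauss)"
    by (intro Bochner_Integration.integral_add[symmetric] integrable_std_gauss_relu)
  \<comment> \<open>symmetrizing leaves the absolute moment plus a correction supported on \<open>[-q, q]\<close>\<close>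
  also have "(\<lambda>x. max 0 (x + q) + max 0 (- x + q)) = (\<lambda>x. \<bar>x\<bar> + q + (max 0 (q - \<bar>x\<bar>)) ^ Suc 0)"
    using q by (auto simp: fun_eq_iff max_def)
  also have "(\<integral>x. \<bar>x\<bar> + q + (max 0 (q - \<bar>x\<bar>)) ^ Suc 0 \<partial>std_gauss) =
      sqrt (2 / pi) + q + (\<integral>x. (max 0 (q - \<bar>x\<bar>)) ^ Suc 0 \<partial>std_gauss)"
    using integrable_std_gauss_tent[of q "Suc 0"] integrable_std_gauss_abs
    by (simp add: integral_std_gauss_abs std_gauss.prob_space[simplified] del: power_Suc)
  also have "\<dots> \<le> sqrt (2 / pi) + q + sqrt (2 / pi) / 2 * q\<^sup>2"
    using integral_std_gauss_tent_le[OF q, of 0] by (simp add: numeral_2_eq_2)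
  finally show ?thesis
    by (simp add: field_simps)
qed

lemma integral_std_gauss_relu_square_le:
  assumes q: "0 \<le> q"
  shows "(\<integral>x. (max 0 (x + q))\<^sup>2 \<partial>std_gauss) \<le> (1 + q\<^sup>2 + sqrt (2 / pi) * (2 * q + q ^ 3 / 3)) / 2"
proof -
  have "2 * (\<integral>x. (max 0 (x + q))\<^sup>2 \<partial>std_gauss) =
      (\<integral>x. (max 0 (x + q))\<^sup>2 \<partial>std_gauss) + (\<integral>x. (max 0 (- x + q))\<^sup>2 \<partial>std_gauss)"
    using integral_std_gauss_reflect[of "\<lambda>x. (max 0 (x + q))\<^sup>2"] by simp
  also have "\<dots> = (\<integral>x. (max 0 (x + q))\<^sup>2 + (max 0 (- x + q))\<^sup>2 \<partial>std_gauss)"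
    by (intro Bochner_Integration.integral_add[symmetric] integrable_std_gauss_relu_square)
  \<comment> \<open>The symmetrized square is the square of \<open>\<bar>x\<bar> + q\<close> plus
    the squared tent: the smaller of the two arguments contributes only where
    \<open>\<bar>x\<bar> < q\<close>.\<close>
  also have "(\<lambda>x. (max 0 (x + q))\<^sup>2 + (max 0 (- x + q))\<^sup>2) =
      (\<lambda>x. x\<^sup>2 + 2 * q * \<bar>x\<bar> + q\<^sup>2 + (max 0 (q - \<bar>x\<bar>)) ^ Suc 1)"
    using q by (auto simp: fun_eq_iff max_def power2_eq_square algebra_simps abs_if)
  also have "(\<integral>x. x\<^sup>2 + 2 * q * \<bar>x\<bar> + q\<^sup>2 + (max 0 (q - \<bar>x\<bar>)) ^ Suc 1 \<partial>std_gauss) =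
      1 + 2 * q * sqrt (2 / pi) + q\<^sup>2 + (\<integral>x. (max 0 (q - \<bar>x\<bar>)) ^ Suc 1 \<partial>std_gauss)"
    using integrable_std_gauss_tent[of q "Suc 1"] integrable_std_gauss_abs integrable_std_gauss_power[of 2]
    by (simp add: integral_std_gauss_abs integral_std_gauss_square std_gauss.prob_space[simplified] del: power_Suc)
  also have "\<dots> \<le> 1 + 2 * q * sqrt (2 / pi) + q\<^sup>2 + sqrt (2 / pi) / 3 * q ^ 3"
    using integral_std_gauss_tent_le[OF q, of 1] by (simp add: numeral_3_eq_3)
  finally show ?thesis
    by (simp add: field_simps)
qed

lemma sqrt_2_div_pi_le: "sqrt (2 / pi) \<le> 0.798"
proof (rule real_le_lsqrt)
  show "2 / pi \<le> 0.798\<^sup>2"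
    using pi_approx(1) by (simp add: divide_le_eq power2_eq_square)
qed simp

section \<open>Comparison for the Hamiltonian\<close>

text \<open>Both Gaussian families live on the index set \<open>{1..N} \<times> {0..N}\<close>: column \<open>0\<close> carries the
  comparison field \<open>g\<close>, the other columns carry the couplings. Since the two families then have
  disjoint supports, they are independent.\<close>

definition hcoeff :: "nat \<Rightarrow> (nat \<Rightarrow> real) \<Rightarrow> nat \<times> nat \<Rightarrow> real"
  where "hcoeff N \<eta> x = (case x of (i, j) \<Rightarrow> if j = 0 then 0 else - (\<eta> i * \<eta> j) / sqrt N)"

definition fcoeff :: "nat \<Rightarrow> (nat \<Rightarrow> real) \<Rightarrow> nat \<times> nat \<Rightarrow> real"
  where "fcoeff N \<eta> x = (case x of (i, j) \<Rightarrow> if j = 0 then sqrt (2 * (\<Sum>l=1..N. \<eta> l) / N) * \<eta> i else 0)"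

section \<open>Configurations and the increments of the two processes\<close>

lemma finite_configs: "finite (configs N)"
  unfolding configs_def by (intro finite_PiE) auto

lemma configs_nonempty: "configs N \<noteq> {}"
  unfolding configs_def by (simp add: PiE_eq_empty_iff)

lemma configsD: "\<eta> \<in> configs N \<Longrightarrow> i \<in> {1..N} \<Longrightarrow> \<eta> i = 0 \<or> \<eta> i = 1"
  unfolding configs_def by (auto dest!: PiE_mem)

lemma configs_square: "\<eta> \<in> configs N \<Longrightarrow> i \<in> {1..N} \<Longrightarrow> (\<eta> i)\<^sup>2 = \<eta> i"
  using configsD by fastforce

lemma sum_configs_nonneg: "\<eta> \<in> configs N \<Longrightarrow> 0 \<le> (\<Sum>i=1..N. \<eta> i)"
  by (rule sum_nonneg) (use configsD in fastforce)

lemma sum_Times_atMost: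
  fixes f :: "nat \<times> nat \<Rightarrow> real"
  shows "(\<Sum>x\<in>{1..N} \<times> {0..N}. f x) = (\<Sum>i=1..N. f (i, 0)) + (\<Sum>i=1..N. \<Sum>j=1..N. f (i, j))"
  by (simp add: sum.cartesian_product' sum.atLeast_Suc_atMost sum.distrib)

text \<open>The minus sign in \<open>hcoeff\<close> turns the minimum of the Hamiltonian into the
  maximum of a linear form in the couplings.\<close>

lemma min_density_eq_Max:
  "min_density N (\<lambda>i j. w (i, j)) =
    Max ((\<lambda>\<eta>. \<Sum>x\<in>{1..N} \<times> {1..N}. hcoeff N \<eta> x * w x) ` configs N) / N"
proof -
  have "- hamiltonian N (\<lambda>i j. w (i, j)) \<eta> = (\<Sum>x\<in>{1..N} \<times> {1..N}. hcoeff N \<eta> x * w x)" for \<eta>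
    by (simp add: hamiltonian_def hcoeff_def sum.cartesian_product' sum_distrib_left sum_negf[symmetric]
        mult_ac)
  then show ?thesis
    using finite_configs[of N] configs_nonempty[of N]
    by (simp add: min_density_def image_image)
qed

lemma sum_hcoeff_restrict:
  "(\<Sum>x\<in>{1..N} \<times> {0..N}. hcoeff N \<eta> x * w x) = (\<Sum>x\<in>{1..N} \<times> {1..N}. hcoeff N \<eta> x * w x)"
  by (rule sum.mono_neutral_right) (auto simp: hcoeff_def Suc_le_eq split: if_splits)

text \<open>Entries in {0, 1} equal their squares, so the square terms sum to squared cardinalities,
  and the cross term factors into the square of the overlap.\<close>

lemma hcoeff_increment:
  assumes N: "N \<ge> 1" and s: "s \<in> configs N" and t: "t \<in> configs N"
  shows "(\<Sum>x\<in>{1..N} \<times> {0..N}. (hcoeff N t x - hcoeff N s x)\<^sup>2) =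
    ((\<Sum>i=1..N. t i)\<^sup>2 + (\<Sum>i=1..N. s i)\<^sup>2 - 2 * (\<Sum>i=1..N. t i * s i)\<^sup>2) / N"
proof -
  have "(\<Sum>x\<in>{1..N} \<times> {0..N}. (hcoeff N t x - hcoeff N s x)\<^sup>2) =
      (\<Sum>i=1..N. \<Sum>j=1..N. (t i * t j + s i * s j - 2 * ((t i * s i) * (t j * s j))) / N)"
    unfolding sum_Times_atMost
  proof -
    have "(hcoeff N t (i, j) - hcoeff N s (i, j))\<^sup>2 =
        (t i * t j + s i * s j - 2 * ((t i * s i) * (t j * s j))) / N"
      if "i \<in> {1..N}" "j \<in> {1..N}" for i j
    proof -
      have "(hcoeff N t (i, j) - hcoeff N s (i, j))\<^sup>2 = (t i * t j - s i * s j)\<^sup>2 / N"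
        using that N by (simp add: hcoeff_def power_divide power2_commute flip: diff_divide_distrib)
      also have "(t i * t j - s i * s j)\<^sup>2 =
          (t i)\<^sup>2 * (t j)\<^sup>2 + (s i)\<^sup>2 * (s j)\<^sup>2 - 2 * ((t i * s i) * (t j * s j))"
        by (simp add: power2_diff power_mult_distrib mult_ac)
      finally show ?thesis
        using that s t by (simp add: configs_square)
    qed
    then show "(\<Sum>i=1..N. (hcoeff N t (i, 0) - hcoeff N s (i, 0))\<^sup>2) +
        (\<Sum>i=1..N. \<Sum>j=1..N. (hcoeff N t (i, j) - hcoeff N s (i, j))\<^sup>2) =
      (\<Sum>i=1..N. \<Sum>j=1..N. (t i * t j + s i * s j - 2 * ((t i * s i) * (t j * s j))) / N)"
      by (simp add: hcoeff_def[of _ _ "(_, 0)"])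
  qed
  also have "\<dots> = ((\<Sum>i=1..N. t i)\<^sup>2 + (\<Sum>i=1..N. s i)\<^sup>2 - 2 * (\<Sum>i=1..N. t i * s i)\<^sup>2) / N"
  proof -
    have sq: "(\<Sum>i=1..N. \<Sum>j=1..N. f i * f j) = (\<Sum>i=1..N. f i)\<^sup>2" for f :: "nat \<Rightarrow> real"
      by (simp add: power2_eq_square sum_product)
    show ?thesis
      using sq[of t] sq[of s] sq[of "\<lambda>i. t i * s i"]
      by (simp only: sum_divide_distrib[symmetric] sum_subtractf sum.distrib sum_distrib_left[symmetric, of 2])
  qed
  finally show ?thesis .
qed

lemma fcoeff_increment:
  assumes N: "N \<ge> 1" and s: "s \<in> configs N" and t: "t \<in> configs N"
  shows "(\<Sum>x\<in>{1..N} \<times> {0..N}. (fcoeff N t x - fcoeff N s x)\<^sup>2) =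
    2 * ((\<Sum>i=1..N. t i)\<^sup>2 + (\<Sum>i=1..N. s i)\<^sup>2 -
      2 * (sqrt (\<Sum>i=1..N. t i) * sqrt (\<Sum>i=1..N. s i)) * (\<Sum>i=1..N. t i * s i)) / N"
proof -
  define k l where "k = (\<Sum>i=1..N. t i)" and "l = (\<Sum>i=1..N. s i)"
  have kl: "0 \<le> k" "0 \<le> l"
    unfolding k_def l_def by (rule sum_configs_nonneg[OF t] sum_configs_nonneg[OF s])+
  have "(\<Sum>x\<in>{1..N} \<times> {0..N}. (fcoeff N t x - fcoeff N s x)\<^sup>2) =
      (\<Sum>i=1..N. (fcoeff N t (i, 0) - fcoeff N s (i, 0))\<^sup>2)"
    unfolding sum_Times_atMost by (simp add: fcoeff_def)
  also have "\<dots> = (\<Sum>i=1..N. 2 / N * (k * t i + l * s i - 2 * (sqrt k * sqrt l) * (t i * s i)))"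
  proof (rule sum.cong[OF refl])
    fix i assume i: "i \<in> {1..N}"
    have "fcoeff N t (i, 0) - fcoeff N s (i, 0) = sqrt (2 / N) * (sqrt k * t i - sqrt l * s i)"
      by (simp add: fcoeff_def k_def l_def right_diff_distrib real_sqrt_mult real_sqrt_divide)
    also have "\<dots>\<^sup>2 = 2 / N * ((sqrt k)\<^sup>2 * (t i)\<^sup>2 + (sqrt l)\<^sup>2 * (s i)\<^sup>2 - 2 * (sqrt k * sqrt l) * (t i * s i))"
      by (simp add: power_mult_distrib power2_diff mult_ac)
    finally show "(fcoeff N t (i, 0) - fcoeff N s (i, 0))\<^sup>2 =
        2 / N * (k * t i + l * s i - 2 * (sqrt k * sqrt l) * (t i * s i))"
      using i s t kl by (simp add: configs_square)
  qed
  also have "\<dots> = 2 / N * (k * k + l * l - 2 * (sqrt k * sqrt l) * (\<Sum>i=1..N. t i * s i))"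
    unfolding sum_distrib_left[symmetric] sum_subtractf sum.distrib by (simp add: k_def l_def)
  finally show ?thesis
    by (simp add: k_def l_def power2_eq_square)
qed

lemma coeff_increment_le:
  assumes "N \<ge> 1" "s \<in> configs N" "t \<in> configs N"
  shows "(\<Sum>x\<in>{1..N} \<times> {0..N}. (hcoeff N t x - hcoeff N s x)\<^sup>2) \<le>
    (\<Sum>x\<in>{1..N} \<times> {0..N}. (fcoeff N t x - fcoeff N s x)\<^sup>2)"
proof -
  define k l r where "k = (\<Sum>i=1..N. t i)" and "l = (\<Sum>i=1..N. s i)" and "r = (\<Sum>i=1..N. t i * s i)"
  have "(sqrt k * sqrt l)\<^sup>2 = k * l"
    using sum_configs_nonneg[OF assms(2)] sum_configs_nonneg[OF assms(3)]
    by (simp add: k_def l_def power_mult_distrib)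
  then have "2 * (k\<^sup>2 + l\<^sup>2 - 2 * (sqrt k * sqrt l) * r) - (k\<^sup>2 + l\<^sup>2 - 2 * r\<^sup>2) =
      (k - l)\<^sup>2 + 2 * (sqrt k * sqrt l - r)\<^sup>2"
    by (simp add: power2_diff algebra_simps)
  then have "k\<^sup>2 + l\<^sup>2 - 2 * r\<^sup>2 \<le> 2 * (k\<^sup>2 + l\<^sup>2 - 2 * (sqrt k * sqrt l) * r)"
    by (smt (verit) zero_le_power2)
  then show ?thesis
    unfolding hcoeff_increment[OF assms] fcoeff_increment[OF assms]
    by (simp add: divide_right_mono k_def l_def r_def)
qed

lemma expectation_hcoeff_le_fcoeff:
  assumes "N \<ge> 1"
  shows "(\<integral>w. Max ((\<lambda>\<eta>. \<Sum>x\<in>{1..N} \<times> {0..N}. hcoeff N \<eta> x * w x) ` configs N)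
      \<partial>std_gauss_PiM ({1..N} \<times> {0..N})) \<le>
    (\<integral>w. Max ((\<lambda>\<eta>. \<Sum>x\<in>{1..N} \<times> {0..N}. fcoeff N \<eta> x * w x) ` configs N)
      \<partial>std_gauss_PiM ({1..N} \<times> {0..N}))"
  using assms
  by (intro sudakov_fernique finite_configs configs_nonempty coeff_increment_le sum.neutral)
    (auto simp: hcoeff_def fcoeff_def)

section \<open>Pointwise bound for the maximum of the comparison process\<close>

lemma cubic_le:
  fixes A y :: real
  assumes "0 \<le> A" "0 \<le> y"
  shows "A * y - y ^ 3 / 3 \<le> (A\<^sup>2 + A) / 3"
proof -
  \<comment> \<open>with \<open>A = u\<^sup>2\<close>, the left-hand side is at most \<open>2/3\<close> of the cube of \<open>u\<close>, and AM-GM finishes\<close>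
  define u where "u = sqrt A"
  have u: "0 \<le> u" "A = u\<^sup>2"
    using assms by (auto simp: u_def)
  \<comment> \<open>These expand to \<open>2 u^3 - 3 u^2 y + y^3\<close> and
    \<open>u^4 - 2 u^3 + u^2\<close>; one third of their sum is exactly the gap in the
    claim.\<close>
  have "0 \<le> (u - y)\<^sup>2 * (2 * u + y)" "0 \<le> (u\<^sup>2 - u)\<^sup>2"
    using u assms by auto
  then show ?thesis
    unfolding u by (simp add: power2_eq_square power3_eq_cube algebra_simps)
qed

text \<open>Configurations enter only through \<open>y\<close>, the square root of their density,
  once the linear field is bounded by its positive parts. The threshold 1/3 puts the maximum of the
  resulting cubic at \<open>y = sqrt (A w)\<close>, and the final bound is quadratic in
  \<open>A w\<close>, so two moments determine its expectation.\<close>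

lemma Max_fcoeff_le:
  assumes N: "N \<ge> 1"
  defines "A \<equiv> \<lambda>w. (\<Sum>i=1..N. max 0 (w (i, 0) + 1 / 3)) / N"
  shows "Max ((\<lambda>\<eta>. \<Sum>x\<in>{1..N} \<times> {0..N}. fcoeff N \<eta> x * w x) ` configs N) \<le>
    N * (sqrt 2 / 3) * ((A w)\<^sup>2 + A w)"
proof -
  have "(\<Sum>x\<in>{1..N} \<times> {0..N}. fcoeff N \<eta> x * w x) \<le> N * (sqrt 2 / 3) * ((A w)\<^sup>2 + A w)"
    if \<eta>: "\<eta> \<in> configs N" for \<eta>
  proof -
    define k where "k = (\<Sum>i=1..N. \<eta> i)"
    define y where "y = sqrt (k / N)"
    have k: "0 \<le> k"
      unfolding k_def using \<eta> by (rule sum_configs_nonneg)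
    then have y: "0 \<le> y" "k = N * y\<^sup>2"
      using N by (simp_all add: y_def)
    \<comment> \<open>Lagrangian bound for the sum of the \<open>k\<close> largest fields, with threshold \<open>-1/3\<close>\<close>
    have "(\<Sum>i=1..N. \<eta> i * w (i, 0)) \<le> (\<Sum>i=1..N. max 0 (w (i, 0) + 1 / 3) - \<eta> i / 3)"
      by (rule sum_mono) (use configsD[OF \<eta>] in fastforce)
    also have "\<dots> = N * A w - k / 3"
      using N by (simp add: A_def k_def sum_subtractf flip: sum_divide_distrib)
    finally have le: "(\<Sum>i=1..N. \<eta> i * w (i, 0)) \<le> N * A w - k / 3" .
    have "(\<Sum>x\<in>{1..N} \<times> {0..N}. fcoeff N \<eta> x * w x) = sqrt 2 * y * (\<Sum>i=1..N. \<eta> i * w (i, 0))"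
    proof -
      have "sqrt (2 * k / N) = sqrt 2 * y"
        by (simp add: y_def real_sqrt_mult real_sqrt_divide)
      then have "fcoeff N \<eta> (i, 0) = sqrt 2 * y * \<eta> i" for i
        unfolding k_def by (simp add: fcoeff_def)
      moreover have "fcoeff N \<eta> (i, j) = 0" if "j \<in> {1..N}" for i j
        using that by (simp add: fcoeff_def)
      ultimately show ?thesis
        unfolding sum_Times_atMost by (simp add: sum_distrib_left mult.assoc)
    qed
    also have "\<dots> \<le> sqrt 2 * y * (N * A w - k / 3)"
      using y le by (intro mult_left_mono) auto
    also have "\<dots> = N * sqrt 2 * (A w * y - y ^ 3 / 3)"
      unfolding y(2) by (simp add: power2_eq_square power3_eq_cube algebra_simps)
    also have "\<dots> \<le> N * sqrt 2 * (((A w)\<^sup>2 + A w) / 3)"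
      by (intro mult_left_mono cubic_le y) (auto simp: A_def sum_nonneg)
    finally show ?thesis
      by simp
  qed
  then show ?thesis
    using finite_configs configs_nonempty by (intro Max.boundedI) auto
qed

section \<open>First and second moments of sums of independent coordinates\<close>

lemma std_gauss_PiM_pair:
  fixes f g :: "real \<Rightarrow> real"
  assumes I: "finite I" "i \<in> I" "l \<in> I" "i \<noteq> l"
    and int: "integrable std_gauss f" "integrable std_gauss g"
  shows "integrable (std_gauss_PiM I) (\<lambda>w. f (w i) * g (w l))"
    and "(\<integral>w. f (w i) * g (w l) \<partial>std_gauss_PiM I) = (\<integral>x. f x \<partial>std_gauss) * (\<integral>x. g x \<partial>std_gauss)"
proof -
  define F where "F k = (if k = i then f else if k = l then g else (\<lambda>_. 1))" for k
  \<comment> \<open>The product over all coordinates is padded with the constant 1 away from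
    \<open>i\<close> and \<open>l\<close>. Generality in \<open>\<phi>\<close> lets one computation
    serve both for pointwise evaluation and for integrals, where the padding has integral 1.\<close>
  have F: "(\<Prod>k\<in>I. \<phi> (F k) k) = \<phi> f i * \<phi> g l" if "\<And>k. \<phi> (\<lambda>_. 1) k = 1"
    for \<phi> :: "(real \<Rightarrow> real) \<Rightarrow> 'a \<Rightarrow> real"
  proof -
    have "(\<Prod>k\<in>I - {i} - {l}. \<phi> (F k) k) = 1"
      by (intro prod.neutral) (auto simp: F_def that)
    then show ?thesis
      using I prod.remove[of I i "\<lambda>k. \<phi> (F k) k"] prod.remove[of "I - {i}" l "\<lambda>k. \<phi> (F k) k"]
      by (simp add: F_def)
  qed
  have FI: "integrable std_gauss (F k)" for k
    using int by (simp add: F_def)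
  have eq: "(\<Prod>k\<in>I. F k (w k)) = f (w i) * g (w l)" for w
    using F[of "\<lambda>h k. h (w k)"] by simp
  show "integrable (std_gauss_PiM I) (\<lambda>w. f (w i) * g (w l))"
    using gauss_prod.product_integrable_prod[of I F] FI I by (simp add: eq)
  show "(\<integral>w. f (w i) * g (w l) \<partial>std_gauss_PiM I) = (\<integral>x. f x \<partial>std_gauss) * (\<integral>x. g x \<partial>std_gauss)"
    using gauss_prod.product_integral_prod[of I F] FI I F[of "\<lambda>h k. \<integral>x. h x \<partial>std_gauss"]
    by (simp add: eq std_gauss.prob_space[simplified])
qed

text \<open>Expanding the square gives \<open>card S\<close> diagonal terms, each a second moment,
  and off-diagonal terms that factor by independence.\<close>

lemma integral_square_sum:
  fixes f :: "real \<Rightarrow> real"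
  assumes I: "finite I" "S \<subseteq> I"
    and int: "integrable std_gauss f" "integrable std_gauss (\<lambda>x. (f x)\<^sup>2)"
  shows "integrable (std_gauss_PiM I) (\<lambda>w. (\<Sum>i\<in>S. f (w i))\<^sup>2)"
    and "(\<integral>w. (\<Sum>i\<in>S. f (w i))\<^sup>2 \<partial>std_gauss_PiM I) =
      card S * ((\<integral>x. (f x)\<^sup>2 \<partial>std_gauss) + (real (card S) - 1) * (\<integral>x. f x \<partial>std_gauss)\<^sup>2)"
proof -
  let ?c = "\<lambda>i l. if l = i then (\<integral>x. (f x)\<^sup>2 \<partial>std_gauss) else (\<integral>x. f x \<partial>std_gauss)\<^sup>2"
  have S: "finite S"
    using I finite_subset by auto
  have [measurable]: "f \<in> borel_measurable borel"
    using borel_measurable_integrable[OF int(1)] by simp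
  have pair: "integrable (std_gauss_PiM I) (\<lambda>w. f (w i) * f (w l)) \<and>
      (\<integral>w. f (w i) * f (w l) \<partial>std_gauss_PiM I) = ?c i l" if "i \<in> S" "l \<in> S" for i l
  proof (cases "l = i")
    case True
    have "i \<in> I"
      using that I by auto
    then show ?thesis
      using True integrable_PiM_component[OF _ int(2)] integral_PiM_component[of i I "\<lambda>x. (f x)\<^sup>2"]
      by (simp add: power2_eq_square)
  next
    case False
    then show ?thesis
      using std_gauss_PiM_pair[of I i l f f] that I int(1) by (auto simp: power2_eq_square)
  qed
  have sq: "(\<lambda>w. (\<Sum>i\<in>S. f (w i))\<^sup>2) = (\<lambda>w. \<Sum>i\<in>S. \<Sum>l\<in>S. f (w i) * f (w l))"
    by (simp add: power2_eq_square sum_product)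
  show "integrable (std_gauss_PiM I) (\<lambda>w. (\<Sum>i\<in>S. f (w i))\<^sup>2)"
    unfolding sq using pair by (intro Bochner_Integration.integrable_sum) auto
  have "(\<integral>w. (\<Sum>i\<in>S. f (w i))\<^sup>2 \<partial>std_gauss_PiM I) = (\<Sum>i\<in>S. \<Sum>l\<in>S. ?c i l)"
    unfolding sq using pair
    by (subst Bochner_Integration.integral_sum) (auto simp: Bochner_Integration.integral_sum intro!: sum.cong)
  also have "\<dots> = (\<Sum>i\<in>S. (\<integral>x. (f x)\<^sup>2 \<partial>std_gauss) + (real (card S) - 1) * (\<integral>x. f x \<partial>std_gauss)\<^sup>2)"
  proof (rule sum.cong[OF refl])
    fix i assume i: "i \<in> S"
    then have "card S \<ge> 1"
      using S by (auto simp: Suc_le_eq card_gt_0_iff)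
    moreover have "(\<Sum>l\<in>S - {i}. ?c i l) = (\<Sum>l\<in>S - {i}. (\<integral>x. f x \<partial>std_gauss)\<^sup>2)"
      by (rule sum.cong) auto
    ultimately show "(\<Sum>l\<in>S. ?c i l) = (\<integral>x. (f x)\<^sup>2 \<partial>std_gauss) + (real (card S) - 1) * (\<integral>x. f x \<partial>std_gauss)\<^sup>2"
      using S i sum.remove[OF S i, of "?c i"] by (simp add: of_nat_diff)
  qed
  finally show "(\<integral>w. (\<Sum>i\<in>S. f (w i))\<^sup>2 \<partial>std_gauss_PiM I) =
      card S * ((\<integral>x. (f x)\<^sup>2 \<partial>std_gauss) + (real (card S) - 1) * (\<integral>x. f x \<partial>std_gauss)\<^sup>2)"
    by simp
qed

text \<open>The moment estimates at \<open>q = 1 / 3\<close> with 0.798 for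
  \<open>sqrt (2 / pi)\<close> give about 0.5878 and 0.8265, rounded up here.\<close>

lemma relu_third_bounds:
  "0 \<le> (\<integral>x. max 0 (x + 1 / 3) \<partial>std_gauss)"
  "(\<integral>x. max 0 (x + 1 / 3) \<partial>std_gauss) \<le> 0.588"
  "(\<integral>x. (max 0 (x + 1 / 3))\<^sup>2 \<partial>std_gauss) \<le> 0.827"
proof -
  show "0 \<le> (\<integral>x. max 0 (x + 1 / 3) \<partial>std_gauss)"
    by (intro Bochner_Integration.integral_nonneg) simp
  show "(\<integral>x. max 0 (x + 1 / 3) \<partial>std_gauss) \<le> 0.588"
    using integral_std_gauss_relu_le[of "1 / 3"] sqrt_2_div_pi_le by (simp add: power2_eq_square)
  show "(\<integral>x. (max 0 (x + 1 / 3))\<^sup>2 \<partial>std_gauss) \<le> 0.827"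
    using integral_std_gauss_relu_square_le[of "1 / 3"] sqrt_2_div_pi_le
    by (simp add: power2_eq_square power3_eq_cube)
qed

lemma expectation_Max_fcoeff_le:
  assumes N: "N \<ge> 2"
  defines "I \<equiv> {1..N} \<times> {0..N}"
  shows "(\<integral>w. Max ((\<lambda>\<eta>. \<Sum>x\<in>I. fcoeff N \<eta> x * w x) ` configs N) \<partial>std_gauss_PiM I) < 0.562 * N"
proof -
  define h where "h x = max 0 (x + 1 / 3)" for x :: real
  define S where "S = {1..N} \<times> {0 :: nat}"
  define a where "a = (\<integral>x. h x \<partial>std_gauss)"
  define b where "b = (\<integral>x. (h x)\<^sup>2 \<partial>std_gauss)"
  have ab: "0 \<le> a" "a \<le> 0.588" "b \<le> 0.827"
    using relu_third_bounds by (simp_all add: a_def b_def h_def)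
  have int: "integrable std_gauss h" "integrable std_gauss (\<lambda>x. (h x)\<^sup>2)"
    unfolding h_def by (rule integrable_std_gauss_relu integrable_std_gauss_relu_square)+
  have [measurable]: "h \<in> borel_measurable borel"
    unfolding h_def by measurable
  have I: "finite I" "S \<subseteq> I" "card S = N"
    by (auto simp: I_def S_def)
  let ?s = "\<lambda>w. \<Sum>x\<in>S. h (w x)"
  have s1: "integrable (std_gauss_PiM I) ?s"
    using I by (intro Bochner_Integration.integrable_sum integrable_PiM_component int) auto
  have s2: "(\<integral>w. ?s w \<partial>std_gauss_PiM I) = N * a"
  proof -
    have "(\<integral>w. ?s w \<partial>std_gauss_PiM I) = (\<Sum>x\<in>S. (\<integral>w. h (w x) \<partial>std_gauss_PiM I))"
      using I by (intro Bochner_Integration.integral_sum integrable_PiM_component int) auto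
    also have "\<dots> = (\<Sum>x\<in>S. a)"
      unfolding a_def using I by (intro sum.cong refl integral_PiM_component) auto
    finally show ?thesis
      using I by simp
  qed
  note s3 = integral_square_sum[OF I(1,2) int, folded a_def b_def, unfolded I(3)]
  have "(\<integral>w. Max ((\<lambda>\<eta>. \<Sum>x\<in>I. fcoeff N \<eta> x * w x) ` configs N) \<partial>std_gauss_PiM I) \<le>
      (\<integral>w. N * (sqrt 2 / 3) * ((?s w)\<^sup>2 / N\<^sup>2 + ?s w / N) \<partial>std_gauss_PiM I)"
  proof (rule integral_mono)
    show "integrable (std_gauss_PiM I) (\<lambda>w. Max ((\<lambda>\<eta>. \<Sum>x\<in>I. fcoeff N \<eta> x * w x) ` configs N))"
      by (intro integrable_Max finite_configs configs_nonempty integrable_linear_form)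
    show "integrable (std_gauss_PiM I) (\<lambda>w. N * (sqrt 2 / 3) * ((?s w)\<^sup>2 / N\<^sup>2 + ?s w / N))"
      using s1 s3(1) by simp
    fix w
    have "?s w = (\<Sum>i=1..N. max 0 (w (i, 0) + 1 / 3))"
      by (simp add: S_def h_def sum.cartesian_product')
    then show "Max ((\<lambda>\<eta>. \<Sum>x\<in>I. fcoeff N \<eta> x * w x) ` configs N) \<le>
        N * (sqrt 2 / 3) * ((?s w)\<^sup>2 / N\<^sup>2 + ?s w / N)"
      using Max_fcoeff_le[of N w] N by (simp add: I_def power_divide)
  qed
  also have "\<dots> = N * (sqrt 2 / 3 * ((b + (real N - 1) * a\<^sup>2) / N + a))"
    using s1 s2 s3 N by (simp add: power2_eq_square)
  also have "\<dots> < N * 0.562"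
  proof (rule mult_strict_left_mono)
    have "a\<^sup>2 \<le> 0.588\<^sup>2"
      using ab by (intro power_mono)
    then have "b + (real N - 1) * a\<^sup>2 \<le> 0.827 + (real N - 1) * 0.588\<^sup>2"
      using ab N by (intro add_mono mult_left_mono) auto
    \<comment> \<open>Nearly sharp at \<open>N = 2\<close>, where it reads 1.172744 against 1.174,
      and weaker for larger \<open>N\<close> since \<open>0.588^2 < 0.587\<close>. At
      \<open>N = 1\<close> it fails, as 0.827 exceeds 0.587.\<close>
    also have "\<dots> \<le> N * 0.587"
      using N by (simp add: power2_eq_square field_simps)
    finally have "(b + (real N - 1) * a\<^sup>2) / N + a \<le> 0.587 + 0.588"
      using N ab by (intro add_mono) (simp_all add: divide_le_eq mult.commute)
    then have "sqrt 2 / 3 * ((b + (real N - 1) * a\<^sup>2) / N + a) \<le> sqrt 2 / 3 * (0.587 + 0.588)"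
      by (intro mult_left_mono) auto
    also have "sqrt 2 \<le> 1.4143"
      by (rule real_le_lsqrt) (auto simp: power2_eq_square)
    then have "sqrt 2 / 3 * (0.587 + 0.588) < (0.562 :: real)"
      by simp
    finally show "sqrt 2 / 3 * ((b + (real N - 1) * a\<^sup>2) / N + a) < 0.562" .
  qed (use N in simp)
  finally show ?thesis
    by (simp add: mult.commute)
qed

section \<open>The case of a single site, and the combined bound\<close>

text \<open>With \<open>x\<close> the only coupling, the maximum is that of 0 and
  \<open>- x\<close>. Both lie below \<open>(1 - x)^2 / 4\<close>, whose Gaussian expectation is
  1/2; for \<open>- x\<close> this is the inequality \<open>0 \<le> (1 + x)^2\<close>.\<close>

lemma expectation_Max_hcoeff_1:
  defines "I \<equiv> {1..1} \<times> {0..1}"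
  shows "(\<integral>w. Max ((\<lambda>\<eta>. \<Sum>x\<in>I. hcoeff 1 \<eta> x * w x) ` configs 1) \<partial>std_gauss_PiM I) \<le> 1 / 2"
proof -
  have I: "(1, 1) \<in> I"
    by (simp add: I_def)
  have "(\<integral>w. Max ((\<lambda>\<eta>. \<Sum>x\<in>I. hcoeff 1 \<eta> x * w x) ` configs 1) \<partial>std_gauss_PiM I) \<le>
      (\<integral>w. (1 - w (1, 1))\<^sup>2 / 4 \<partial>std_gauss_PiM I)"
  proof (rule integral_mono)
    show "integrable (std_gauss_PiM I) (\<lambda>w. Max ((\<lambda>\<eta>. \<Sum>x\<in>I. hcoeff 1 \<eta> x * w x) ` configs 1))"
      by (intro integrable_Max finite_configs configs_nonempty integrable_linear_form)
    show "integrable (std_gauss_PiM I) (\<lambda>w. (1 - w (1, 1))\<^sup>2 / 4)"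
      using integrable_std_gauss_power[of 2] integrable_std_gauss_id
      by (intro integrable_PiM_component[OF I, of "\<lambda>x. (1 - x)\<^sup>2 / 4"]) (simp add: power2_diff)
    fix w :: "nat \<times> nat \<Rightarrow> real"
    have "(\<Sum>x\<in>I. hcoeff 1 \<eta> x * w x) \<le> (1 - w (1, 1))\<^sup>2 / 4" if "\<eta> \<in> configs 1" for \<eta>
    proof -
      have "(\<Sum>x\<in>I. hcoeff 1 \<eta> x * w x) = - (\<eta> 1 * \<eta> 1 * w (1, 1))"
        unfolding I_def sum_Times_atMost by (simp add: hcoeff_def)
      moreover have "- w (1, 1) \<le> (1 - w (1, 1))\<^sup>2 / 4"
        using zero_le_power2[of "1 + w (1, 1)"] by (simp add: power2_eq_square algebra_simps)
      ultimately show ?thesis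
        using configsD[OF that, of 1] by auto
    qed
    then show "Max ((\<lambda>\<eta>. \<Sum>x\<in>I. hcoeff 1 \<eta> x * w x) ` configs 1) \<le> (1 - w (1, 1))\<^sup>2 / 4"
      using finite_configs configs_nonempty by (intro Max.boundedI) auto
  qed
  also have "\<dots> = (\<integral>x. (1 - x)\<^sup>2 / 4 \<partial>std_gauss)"
    by (rule integral_PiM_component[OF I]) measurable
  also have "\<dots> = 1 / 2"
    using integrable_std_gauss_power[of 2] integrable_std_gauss_id
    by (simp add: power2_diff integral_std_gauss_id integral_std_gauss_square std_gauss.prob_space[simplified])
  finally show ?thesis .
qed

lemma expectation_Max_hcoeff_less:
  assumes "N \<ge> 1"
  shows "(\<integral>w. Max ((\<lambda>\<eta>. \<Sum>x\<in>{1..N} \<times> {0..N}. hcoeff N \<eta> x * w x) ` configs N)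
      \<partial>std_gauss_PiM ({1..N} \<times> {0..N})) < 0.562 * N"
proof (cases "N = 1")
  case True
  then show ?thesis
    using expectation_Max_hcoeff_1 by simp
next
  case False
  then show ?thesis
    using expectation_hcoeff_le_fcoeff[OF assms] expectation_Max_fcoeff_le[of N] assms by simp
qed

section \<open>From the product space to arbitrary couplings\<close>

text \<open>Independence makes the joint law the product of the marginals, each of which is
  \<open>std_gauss\<close>. The bound \<open>N \<ge> 1\<close> provides a nonempty index set for
  this characterization.\<close>

lemma iid_std_gaussian_distr:
  assumes "N \<ge> 1" "prob_space M" and iid: "iid_std_gaussian M N J"
  defines "K \<equiv> {1..N} \<times> {1..N}"
  shows "(\<lambda>\<omega>. \<lambda>x\<in>K. J (fst x) (snd x) \<omega>) \<in> measurable M (std_gauss_PiM K)"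
    and "distr M (std_gauss_PiM K) (\<lambda>\<omega>. \<lambda>x\<in>K. J (fst x) (snd x) \<omega>) = std_gauss_PiM K"
proof -
  interpret M: prob_space M by fact
  have dist: "distr M lborel (J (fst x) (snd x)) = std_gauss" "J (fst x) (snd x) \<in> borel_measurable M"
    if "x \<in> K" for x
    using iid that by (auto simp: iid_std_gaussian_def distributed_def K_def std_gauss_def)
  show meas: "(\<lambda>\<omega>. \<lambda>x\<in>K. J (fst x) (snd x) \<omega>) \<in> measurable M (std_gauss_PiM K)"
    using dist(2) by (intro measurable_restrict) (simp add: measurable_cong_sets[OF refl sets_std_gauss])
  have "M.indep_vars (\<lambda>_. borel) (\<lambda>x. J (fst x) (snd x)) K"
    using iid by (simp add: iid_std_gaussian_def K_def case_prod_beta')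
  then have "distr M (Pi\<^sub>M K (\<lambda>_. borel)) (\<lambda>\<omega>. \<lambda>x\<in>K. J (fst x) (snd x) \<omega>) =
      Pi\<^sub>M K (\<lambda>x. distr M borel (J (fst x) (snd x)))"
    using dist(2) assms(1) by (subst (asm) M.indep_vars_iff_distr_eq_PiM') (auto simp: K_def)
  also have "\<dots> = std_gauss_PiM K"
  proof (rule PiM_cong[OF refl])
    fix x assume "x \<in> K"
    then show "distr M borel (J (fst x) (snd x)) = std_gauss"
      using dist(1)[of x] by (simp cong: distr_cong)
  qed
  finally show "distr M (std_gauss_PiM K) (\<lambda>\<omega>. \<lambda>x\<in>K. J (fst x) (snd x) \<omega>) = std_gauss_PiM K"
    by (simp add: distr_cong[OF refl sets_PiM_cong[OF refl sets_std_gauss]])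
qed

theorem mainTheorem2:
  fixes N :: nat and M :: "'a measure" and J :: "nat \<Rightarrow> nat \<Rightarrow> 'a \<Rightarrow> real"
  assumes "N \<ge> 1"
    and "prob_space M"
    and "iid_std_gaussian M N J"
  shows "integrable M (\<lambda>\<omega>. min_density N (\<lambda>i j. J i j \<omega>)) \<and>
    prob_space.expectation M (\<lambda>\<omega>. min_density N (\<lambda>i j. J i j \<omega>)) < 0.562"
proof -
  define K where "K = {1..N} \<times> {1..N}"
  define I where "I = {1..N} \<times> {0..N}"
  define f where "f w = Max ((\<lambda>\<eta>. \<Sum>x\<in>K. hcoeff N \<eta> x * w x) ` configs N)" for w
  define j where "j \<omega> = (\<lambda>x\<in>K. J (fst x) (snd x) \<omega>)" for \<omega>
  note j = iid_std_gaussian_distr[OF assms, folded K_def, folded j_def]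
  \<comment> \<open>Only the coordinates in \<open>K\<close> matter, so restricting a coupling array
    to \<open>K\<close>, as the product space demands, does not change \<open>f\<close>.\<close>
  have f_cong: "f v = f w" if "\<And>x. x \<in> K \<Longrightarrow> v x = w x" for v w
    unfolding f_def using that by (intro arg_cong[where f = Max] image_cong refl sum.cong) simp
  have int: "integrable (std_gauss_PiM K) f"
    unfolding f_def by (intro integrable_Max finite_configs configs_nonempty integrable_linear_form)
  then have [measurable]: "f \<in> borel_measurable (std_gauss_PiM K)"
    by auto
  have md: "min_density N (\<lambda>i j. J i j \<omega>) = f (j \<omega>) / N" for \<omega>
    using min_density_eq_Max[of N "\<lambda>x. J (fst x) (snd x) \<omega>"] f_cong[of "j \<omega>" "\<lambda>x. J (fst x) (snd x) \<omega>"]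
    by (simp add: f_def K_def j_def)
  have "integrable M (\<lambda>\<omega>. f (j \<omega>))"
    using int j by (metis integrable_distr)
  moreover have "(\<integral>\<omega>. f (j \<omega>) \<partial>M) < 0.562 * N"
  proof -
    have "(\<integral>\<omega>. f (j \<omega>) \<partial>M) = (\<integral>w. f w \<partial>std_gauss_PiM K)"
      using integral_distr[OF j(1), of f] j(2) by simp
    \<comment> \<open>The index set grows by column 0, which holds the comparison field; the
      couplings keep their law as a marginal of the larger product.\<close>
    also have "\<dots> = (\<integral>w. f (restrict w K) \<partial>std_gauss_PiM I)"
    proof -
      have KI: "K \<subseteq> I" "finite K"
        by (auto simp: K_def I_def)
      then have "distr (std_gauss_PiM I) (std_gauss_PiM K) (\<lambda>w. restrict w K) = std_gauss_PiM K"
        by (intro gauss_prod.distr_PiM_restrict_finite)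
      then show ?thesis
        using integral_distr[OF measurable_restrict_subset[OF KI(1), of "\<lambda>_. std_gauss"], of f] by simp
    qed
    also have "\<dots> = (\<integral>w. Max ((\<lambda>\<eta>. \<Sum>x\<in>I. hcoeff N \<eta> x * w x) ` configs N) \<partial>std_gauss_PiM I)"
    proof (rule Bochner_Integration.integral_cong[OF refl])
      fix w
      have "f (restrict w K) = f w"
        by (rule f_cong) simp
      then show "f (restrict w K) = Max ((\<lambda>\<eta>. \<Sum>x\<in>I. hcoeff N \<eta> x * w x) ` configs N)"
        unfolding f_def K_def I_def sum_hcoeff_restrict .
    qed
    also have "\<dots> < 0.562 * N"
      unfolding I_def using assms(1) by (rule expectation_Max_hcoeff_less)
    finally show ?thesis .
  qed
  ultimately show ?thesis
    unfolding md using assms(1) by (simp add: divide_less_eq)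
qed

end
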